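(* Let $\Sigma$ be a connected signed graph with Euler-genus spectrum $\mathcal S(\Sigma)$. For $i\in\{0,1\}$ let $\mathcal S_i(\Sigma)=\{x\in\mathcal S(\Sigma): x\equiv i \pmod 2\}$ and, if $\mathcal S_i(\Sigma)\neq\varnothing$, let $\gamma^E_{i,\max}=\max\mathcal S_i(\Sigma)$. If both $\mathcal S_0(\Sigma)$ and $\mathcal S_1(\Sigma)$ are nonempty, then $$\left|\gamma^E_{0,\max}-\gamma^E_{1,\max}\right|=1.$$
   Context: A signed graph $\Sigma=(G,\sigma)$ is a finite graph $G$ together with a map $\sigma:E(G)\to\{+1,-1\}$; it is connected if $G$ is. A cycle of $\Sigma$ is positive if it contains an even number of edges of sign $-1$, and negative otherwise. A surface is a compact (connected) 2-dimensional manifold without boundary, orientable or not. An embedding of a graph $G$ on a surface $S$ is an embedding (homeomorphism onto its image) $\rho:G\to S$ such that every component of $S-\rho(G)$ (a face) is a 2-cell. An embedding of the signed graph $\Sigma=(G,\sigma)$ is an embedding $\rho$ of $G$ on some surface $S$ such that a cycle $C$ of $\Sigma$ is positive if and only if $\rho(C)$ is orientation-preserving on $S$. (Equivalently, in the standard combinatorial encoding, an embedding is given by a rotation system of $G$ together with the edge signature $\sigma$, faces being obtained by the usual face-tracing procedure for embedding schemes.) With $f(\rho)$ the number of faces, the Euler-genus of $\rho$ is $\gamma^E(\rho)=|E(G)|-|V(G)|+2-f(\rho)$. The Euler-genus spectrum of $\Sigma$ is $\mathcal S(\Sigma)=\{\gamma^E(\rho):\rho\text{ is an embedding of }\Sigma\}$.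 *)

theory Defs
  imports "Graph_Theory.Graph_Theory" "HOL-Combinatorics.Orbits"
begin

text \<open>
  The underlying graph is a finite undirected multigraph, loops and parallel edges allowed. It is
  represented by a finite digraph whose arcs are the undirected edges: \<open>tail\<close> and \<open>head\<close> merely
  name the two ends of an edge, and nothing below depends on which end is called which.
\<close>

locale signed_graph = fin_digraph G
  for G :: "('v, 'e) pre_digraph" (structure) +
  fixes \<sigma> :: "'e \<Rightarrow> int"
  assumes sign: "e \<in> arcs G \<Longrightarrow> \<sigma> e = 1 \<or> \<sigma> e = -1"

text \<open>
  A dart is an edge with a direction of traversal: \<open>(e, True)\<close> leaves the tail of \<open>e\<close> and
  \<open>(e, False)\<close> leaves its head. In particular, a loop has two darts at its vertex.
\<close>

type_synonym 'e dart = "'e \<times> bool"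

definition darts :: "('v, 'e) pre_digraph \<Rightarrow> 'e dart set" where
  "darts G = arcs G \<times> UNIV"

definition dart_origin :: "('v, 'e) pre_digraph \<Rightarrow> 'e dart \<Rightarrow> 'v" where
  "dart_origin G d = (if snd d then tail G (fst d) else head G (fst d))"

definition darts_at :: "('v, 'e) pre_digraph \<Rightarrow> 'v \<Rightarrow> 'e dart set" where
  "darts_at G v = {d \<in> darts G. dart_origin G d = v}"

definition dart_rev :: "'e dart \<Rightarrow> 'e dart" where
  "dart_rev d = (fst d, \<not> snd d)"

definition rotation_system :: "('v, 'e) pre_digraph \<Rightarrow> ('e dart \<Rightarrow> 'e dart) \<Rightarrow> bool" where
  "rotation_system G \<pi> \<longleftrightarrow>
     \<pi> permutes darts G \<and>
     (\<forall>v \<in> verts G. darts_at G v \<noteq> {} \<longrightarrow> cyclic_on \<pi> (darts_at G v))"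

text \<open>
  By the standard encoding of cellular embeddings by embedding schemes, the embeddings of the
  signed graph \<open>(G, \<sigma>)\<close> are given by the rotation systems \<open>\<pi>\<close> of \<open>G\<close> together with the
  signature \<open>\<sigma>\<close> itself: an edge has sign \<open>-1\<close> iff the local orientations that \<open>\<pi>\<close>
  fixes at its ends disagree along it, so that a cycle is orientation-preserving iff it has an
  even number of edges of sign \<open>-1\<close>.

  Face tracing runs on pairs of a dart about to be traversed and the sense, \<open>1\<close> or \<open>-1\<close>,
  in which rotations are currently read. The sense is multiplied by the sign of each edge
  traversed.
\<close>

definition face_step :: "('e \<Rightarrow> int) \<Rightarrow> ('e dart \<Rightarrow> 'e dart) \<Rightarrow> 'e dart \<times> int \<Rightarrow> 'e dart \<times> int" where
  "face_step \<sigma> \<pi> = (\<lambda>(d, s).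
     let t = s * \<sigma> (fst d)
     in ((if t = 1 then \<pi> else inv \<pi>) (dart_rev d), t))"

text \<open>
  The same passage along an edge, seen in the opposite direction. The sense in which rotations are
  read is then the opposite of the one after the original passage.
\<close>

definition state_rev :: "('e \<Rightarrow> int) \<Rightarrow> 'e dart \<times> int \<Rightarrow> 'e dart \<times> int" where
  "state_rev \<sigma> = (\<lambda>(d, s). (dart_rev d, - (s * \<sigma> (fst d))))"

text \<open>
  Each face boundary is traced by two orbits of \<open>face_step\<close>, one for each direction; a face is
  represented by the union of the two.
\<close>

definition faces :: "('v, 'e) pre_digraph \<Rightarrow> ('e \<Rightarrow> int) \<Rightarrow> ('e dart \<Rightarrow> 'e dart)
    \<Rightarrow> ('e dart \<times> int) set set" where
  "faces G \<sigma> \<pi> =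
     (\<lambda>x. orbit (face_step \<sigma> \<pi>) x \<union> orbit (face_step \<sigma> \<pi>) (state_rev \<sigma> x)) `
       (darts G \<times> {1, -1})"

text \<open>
  A connected graph without edges is a single vertex. Its only embedding is that in the sphere,
  with one face, which face tracing does not see.
\<close>

definition num_faces :: "('v, 'e) pre_digraph \<Rightarrow> ('e \<Rightarrow> int) \<Rightarrow> ('e dart \<Rightarrow> 'e dart) \<Rightarrow> nat" where
  "num_faces G \<sigma> \<pi> = (if arcs G = {} then 1 else card (faces G \<sigma> \<pi>))"

definition euler_genus :: "('v, 'e) pre_digraph \<Rightarrow> ('e \<Rightarrow> int) \<Rightarrow> ('e dart \<Rightarrow> 'e dart) \<Rightarrow> int" where
  "euler_genus G \<sigma> \<pi> =
     int (card (arcs G)) - int (card (verts G)) + 2 - int (num_faces G \<sigma> \<pi>)"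

definition euler_genus_spectrum :: "('v, 'e) pre_digraph \<Rightarrow> ('e \<Rightarrow> int) \<Rightarrow> int set" where
  "euler_genus_spectrum G \<sigma> = {euler_genus G \<sigma> \<pi> | \<pi>. rotation_system G \<pi>}"

definition parity_spectrum :: "('v, 'e) pre_digraph \<Rightarrow> ('e \<Rightarrow> int) \<Rightarrow> int \<Rightarrow> int set" where
  "parity_spectrum G \<sigma> i = {x \<in> euler_genus_spectrum G \<sigma>. x mod 2 = i mod 2}"

text \<open>The spectrum is finite, so that \<open>Max\<close> of a nonempty part of it is a genuine maximum.\<close>

lemma finite_euler_genus_spectrum:
  assumes "signed_graph G \<sigma>"
  shows "finite (euler_genus_spectrum G \<sigma>)"
proof -
  interpret signed_graph G \<sigma> by fact
  have "finite (darts G)" by (simp add: darts_def)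
  then have "finite {\<pi>. \<pi> permutes darts G}" by (rule finite_permutations)
  then have "finite {\<pi>. rotation_system G \<pi>}"
    by (rule rev_finite_subset) (auto simp: rotation_system_def)
  then show ?thesis
    by (auto simp: euler_genus_spectrum_def intro: finite_image_set)
qed

lemma finite_parity_spectrum:
  "signed_graph G \<sigma> \<Longrightarrow> finite (parity_spectrum G \<sigma> i)"
  by (simp add: parity_spectrum_def finite_euler_genus_spectrum)

end

theory Submission
  imports Defs "HOL-Library.Z2" "HOL-Library.Function_Algebras" Complex_Main
begin

text \<open>
  A rotation system gives a symmetric form over GF(2) on the cycle space whose radical has dimension
  \<open>f - 1\<close> for a connected graph, \<open>f\<close> being the number of faces. Its diagonal depends only on the signs.
  Hence there is a cycle \<open>w\<close> with \<open>Q w y = Q y y\<close> for all \<open>y\<close>, and the parity of the rank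
  is \<open>Q w w\<close>. Moving one dart \<open>t\<close> past a block \<open>B\<close> of darts at the same vertex adds to the form the
  product of the functionals \<open>x t\<close> and \<open>\<Sum>b\<in>B. x b\<close>, symmetrised. If this increases the
  dimension of the radical by two, both functionals vanish at \<open>w\<close>.

  Take a rotation system with the fewest faces \<open>f\<close> and one of the other parity, with as few
  inversions between them as possible, and suppose that \<open>f + 1\<close> faces never occur. Every move from the
  first towards the second then creates at least two faces, which forces \<open>w\<close> to vanish on all darts
  involved in an inversion. So \<open>w\<close> serves the second form as well, and the parities agree: a
  contradiction.
\<close>

section \<open>Symmetric forms over GF(2)\<close>

text \<open>The greatest Euler genus belongs to the fewest faces. Walking from there by single moves
  to an embedding of the other parity does not by itself meet \<open>f + 1\<close>: a move adds a
  form of rank at most 2, so it may change the number of faces by two and jump over that value. The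
  vector \<open>w\<close> sees the parity, and a jump by two constrains it, which is what makes it
  worth carrying along. The form is the intersection form modulo 2: the cycles of the graph fill the
  first homology of the surface, and the radical consists of the boundaries of sets of faces. No
  homology is set up; the form is read off from the order of the darts, and its radical is found by
  colouring the corners of the faces. Cyclic orders are cut open into linear ones, given by real
  ranks: inversions then make sense, and there is always room to place a dart next to another.
  Dimensions appear as cardinalities, so a gain of two is a factor of 4.\<close>

declare add_bit_eq_xor [simp del] mult_bit_eq_and [simp del]

lemma bit_add_self [simp]: "a + a = 0" for a :: bit
  by (cases a) simp_all

lemma bit_add_self_left [simp]: "a + (a + b) = b" for a b :: bit
  by (simp flip: add.assoc)

lemma bit_add_eq_0_iff: "a + b = 0 \<longleftrightarrow> a = b" for a b :: bit
  by (cases a; cases b) simp_all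

section \<open>Groups of exponent two and their functionals\<close>

locale two_group =
  fixes Z :: "'a::ab_group_add set"
  assumes zero_mem [simp, intro]: "0 \<in> Z"
    and add_mem [intro]: "x \<in> Z \<Longrightarrow> y \<in> Z \<Longrightarrow> x + y \<in> Z"
    and add_self: "x \<in> Z \<Longrightarrow> x + x = 0"

definition additive_on :: "'a::ab_group_add set \<Rightarrow> ('a \<Rightarrow> 'b::ab_group_add) \<Rightarrow> bool" where
  "additive_on Z \<phi> \<longleftrightarrow> (\<forall>x \<in> Z. \<forall>y \<in> Z. \<phi> (x + y) = \<phi> x + \<phi> y)"

lemma additive_onD: "additive_on Z \<phi> \<Longrightarrow> x \<in> Z \<Longrightarrow> y \<in> Z \<Longrightarrow> \<phi> (x + y) = \<phi> x + \<phi> y"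
  by (simp add: additive_on_def)

lemma (in two_group) additive_on_0: "additive_on Z \<phi> \<Longrightarrow> \<phi> 0 = 0"
  using additive_onD[of Z \<phi> 0 0] by simp

lemma (in two_group) sum_mem: "(\<And>i. i \<in> I \<Longrightarrow> g i \<in> Z) \<Longrightarrow> (\<Sum>i\<in>I. g i) \<in> Z"
  by (induction I rule: infinite_finite_induct) auto

lemma (in two_group) additive_on_sum:
  assumes "additive_on Z \<phi>" "\<And>i. i \<in> I \<Longrightarrow> g i \<in> Z"
  shows "\<phi> (\<Sum>i\<in>I. g i) = (\<Sum>i\<in>I. \<phi> (g i))"
  using assms(2)
proof (induction I rule: infinite_finite_induct)
  case (insert i I)
  then show ?case
    using additive_onD[OF assms(1), of "g i" "sum g I"] sum_mem[of I g] by auto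
qed (simp_all add: additive_on_0[OF assms(1)])

lemma (in two_group) two_group_kernel:
  "additive_on Z \<phi> \<Longrightarrow> two_group {x \<in> Z. \<phi> x = 0}"
  by unfold_locales (auto simp: additive_on_0 additive_onD add_self)

text \<open>Translation by a point of the fibre. The codomain is general because the lemma serves
  both bit-valued functionals and the map from corner colourings to edge sets.\<close>

lemma (in two_group) card_fibre:
  assumes "additive_on Z \<phi>" "p \<in> Z" "\<phi> p = c"
  shows "card {x \<in> Z. \<phi> x = c} = card {x \<in> Z. \<phi> x = 0}"
proof -
  have self: "p + (p + x) = x" for x
    using add_self[OF assms(2)] by (simp flip: add.assoc)
  have c2: "c + c = 0"
    using additive_onD[OF assms(1) assms(2) assms(2)] assms(3)
    by (simp add: add_self assms(2) additive_on_0[OF assms(1)])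
  have "bij_betw ((+) p) {x \<in> Z. \<phi> x = c} {x \<in> Z. \<phi> x = 0}"
    by (rule bij_betw_byWitness[where f' = "(+) p"])
      (use assms c2 in \<open>auto simp: self additive_onD\<close>)
  then show ?thesis by (rule bij_betw_same_card)
qed

lemma (in two_group) card_eq_twice_kernel:
  fixes \<phi> :: "'a \<Rightarrow> bit"
  assumes "finite Z" "additive_on Z \<phi>" "p \<in> Z" "\<phi> p = 1"
  shows "card Z = 2 * card {x \<in> Z. \<phi> x = 0}"
proof -
  have "Z = {x \<in> Z. \<phi> x = 0} \<union> {x \<in> Z. \<phi> x = 1}" using bit.exhaust by blast
  then have "card Z = card {x \<in> Z. \<phi> x = 0} + card {x \<in> Z. \<phi> x = 1}"
    by (subst (1) \<open>Z = _\<close>, subst card_Un_disjoint) (use assms in auto)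
  then show ?thesis using card_fibre[OF assms(2-4)] by simp
qed

text \<open>On the kernel of \<open>\<phi> k\<close> the claim holds with some \<open>J\<close> by
  induction; the error vanishes on that kernel, so it is 0 or \<open>\<phi> k\<close> itself. This
  duality yields the characteristic vectors and, later, the vertex corrections of corner
  heights.\<close>

lemma functional_eq_sum:
  fixes \<phi> :: "'i \<Rightarrow> 'a::ab_group_add \<Rightarrow> bit"
  assumes "finite I" "two_group Z" "\<And>i. i \<in> I \<Longrightarrow> additive_on Z (\<phi> i)" "additive_on Z \<psi>"
    and "\<And>x. x \<in> Z \<Longrightarrow> \<forall>i\<in>I. \<phi> i x = 0 \<Longrightarrow> \<psi> x = 0"
  shows "\<exists>J\<subseteq>I. \<forall>x\<in>Z. \<psi> x = (\<Sum>i\<in>J. \<phi> i x)"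
  using assms
proof (induction I arbitrary: Z rule: finite_induct)
  case empty
  then show ?case by auto
next
  case (insert k I)
  interpret two_group Z by fact
  let ?K = "{x \<in> Z. \<phi> k x = 0}"
  have add: "additive_on Z (\<phi> i)" if "i \<in> insert k I" for i using insert.prems that by auto
  have "\<exists>J\<subseteq>I. \<forall>x\<in>?K. \<psi> x = (\<Sum>i\<in>J. \<phi> i x)"
    by (rule insert.IH)
      (use insert.prems two_group_kernel[OF add[of k]] in \<open>auto simp: additive_on_def\<close>)
  then obtain J where J: "J \<subseteq> I" "\<And>x. x \<in> ?K \<Longrightarrow> \<psi> x = (\<Sum>i\<in>J. \<phi> i x)" by blast
  have finJ: "finite J" and kJ: "k \<notin> J" using J(1) insert.hyps finite_subset by auto
  let ?d = "\<lambda>x. \<psi> x + (\<Sum>i\<in>J. \<phi> i x)"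
  have d_add: "additive_on Z ?d"
    unfolding additive_on_def
  proof (intro ballI)
    fix x y assume "x \<in> Z" "y \<in> Z"
    then have "(\<Sum>i\<in>J. \<phi> i (x + y)) = (\<Sum>i\<in>J. \<phi> i x) + (\<Sum>i\<in>J. \<phi> i y)"
      unfolding sum.distrib[symmetric] using J(1) by (intro sum.cong) (auto intro!: additive_onD[OF add])
    then show "?d (x + y) = ?d x + ?d y"
      using \<open>x \<in> Z\<close> \<open>y \<in> Z\<close> insert.prems(3) by (simp add: additive_onD algebra_simps)
  qed
  have d0: "?d x = 0" if "x \<in> Z" "\<phi> k x = 0" for x using J(2) that by simp
  show ?case
  proof (cases "\<forall>x\<in>Z. ?d x = 0")
    case True
    then show ?thesis using J(1) by (intro exI[of _ J]) (auto simp: bit_add_eq_0_iff)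
  next
    case False
    then obtain p where p: "p \<in> Z" "?d p = 1" by auto
    have kp: "\<phi> k p = 1" using d0[OF p(1)] p(2) by (metis bit_not_one_iff zero_neq_one)
    have "?d x = \<phi> k x" if "x \<in> Z" for x
    proof (cases "\<phi> k x = 1")
      case 1: True
      have "?d (x + p) = 0"
        using 1 kp that p by (intro d0) (auto simp: additive_onD[OF add])
      then show ?thesis
        using additive_onD[OF d_add that p(1)] p(2) 1 by (simp add: bit_add_eq_0_iff)
    qed (use d0 that in simp)
    then have "\<psi> x = (\<Sum>i\<in>insert k J. \<phi> i x)" if "x \<in> Z" for x
      using that finJ kJ by (metis bit_add_self_left add.commute sum.insert)
    then show ?thesis using J(1) by (intro exI[of _ "insert k J"]) auto
  qed
qed

section \<open>Radical, characteristic vector and parity of the rank\<close>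

locale bit_form = two_group Z for Z :: "'a::ab_group_add set" +
  fixes Q :: "'a \<Rightarrow> 'a \<Rightarrow> bit"
  assumes finite_Z: "finite Z"
    and add_left: "x \<in> Z \<Longrightarrow> y \<in> Z \<Longrightarrow> z \<in> Z \<Longrightarrow> Q (x + y) z = Q x z + Q y z"
    and sym: "x \<in> Z \<Longrightarrow> y \<in> Z \<Longrightarrow> Q x y = Q y x"

definition radical :: "'a set \<Rightarrow> ('a \<Rightarrow> 'a \<Rightarrow> bit) \<Rightarrow> 'a set" where
  "radical Z Q = {x \<in> Z. \<forall>y\<in>Z. Q x y = 0}"

context bit_form
begin

lemma add_right: "x \<in> Z \<Longrightarrow> y \<in> Z \<Longrightarrow> z \<in> Z \<Longrightarrow> Q z (x + y) = Q z x + Q z y"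
  using add_left[of x y z] sym[of z x] sym[of z y] sym[of z "x + y"] by (simp add: add_mem)

lemma additive_left: "z \<in> Z \<Longrightarrow> additive_on Z (\<lambda>x. Q x z)"
  and additive_right: "z \<in> Z \<Longrightarrow> additive_on Z (Q z)"
  by (simp_all add: additive_on_def add_left add_right)

lemma zero_left: "z \<in> Z \<Longrightarrow> Q 0 z = 0"
  using additive_on_0[OF additive_left] .

lemma two_group_radical: "two_group (radical Z Q)"
  by unfold_locales (auto simp: radical_def add_self add_left zero_left)

text \<open>The mixed terms are equal by symmetry and cancel in characteristic 2.\<close>

lemma additive_diagonal: "additive_on Z (\<lambda>x. Q x x)"
  unfolding additive_on_def
proof (intro ballI)
  fix x y assume "x \<in> Z" "y \<in> Z"
  then show "Q (x + y) (x + y) = Q x x + Q y y"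
    using sym[of x y] by (simp add: add_left add_right add_mem ac_simps)
qed

text \<open>The vector \<open>w\<close> is the Poincare dual of the first Stiefel-Whitney class (Wu's formula).\<close>

lemma exists_characteristic: "\<exists>w\<in>Z. \<forall>y\<in>Z. Q w y = Q y y"
proof -
  \<comment> \<open>If \<open>Q p x = 0\<close> for every \<open>p\<close>, then
    \<open>p = x\<close> gives \<open>Q x x = 0\<close>, so duality applies.\<close>
  have "\<exists>J\<subseteq>Z. \<forall>x\<in>Z. Q x x = (\<Sum>p\<in>J. Q p x)"
    by (rule functional_eq_sum)
      (use sym finite_Z two_group_axioms in \<open>auto simp: additive_right additive_diagonal\<close>)
  then obtain J where J: "J \<subseteq> Z" "\<And>x. x \<in> Z \<Longrightarrow> Q x x = (\<Sum>p\<in>J. Q p x)" by blast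
  have "Q (\<Sum>p\<in>J. p) y = Q y y" if "y \<in> Z" for y
    using additive_on_sum[OF additive_left[OF that], of J "\<lambda>p. p"] J that by auto
  moreover have "(\<Sum>p\<in>J. p) \<in> Z" using J(1) by (intro sum_mem) auto
  ultimately show ?thesis by blast
qed

end

text \<open>A pair with \<open>Q a b = 1\<close> spans a hyperbolic plane, whose orthogonal
  complement has index 4 and the same radical. The exponent counts the planes split off.\<close>

lemma card_alternating_form:
  assumes "bit_form Z Q" "\<And>x. x \<in> Z \<Longrightarrow> Q x x = 0"
  shows "\<exists>n. card Z = 4 ^ n * card (radical Z Q)"
  using assms
proof (induction "card Z" arbitrary: Z rule: less_induct)
  case less
  interpret bit_form Z Q by fact
  show ?case
  proof (cases "radical Z Q = Z")
    case True
    then show ?thesis by (intro exI[of _ 0]) simp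
  next
    case False
    then obtain a b where ab: "a \<in> Z" "b \<in> Z" "Q a b \<noteq> 0"
      unfolding radical_def by blast
    then have ab: "a \<in> Z" "b \<in> Z" "Q a b = 1" by simp_all
    let ?A = "{x \<in> Z. Q a x = 0}"
    let ?Z = "{x \<in> ?A. Q b x = 0}"
    have ba: "Q b a = 1" using ab sym by auto
    interpret A: two_group ?A by (rule two_group_kernel) (simp add: additive_right ab)
    have addA: "additive_on ?A (Q b)" using additive_right[OF ab(2)] by (auto simp: additive_on_def)
    have "card Z = 2 * card ?A"
      by (rule card_eq_twice_kernel) (use ab finite_Z additive_right in auto)
    also have "card ?A = 2 * card ?Z"
      by (rule A.card_eq_twice_kernel[where p = a])
        (use ab ba finite_Z addA less.prems in auto)
    finally have card_Z: "card Z = 4 * card ?Z" by simp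
    have "card Z > 0" using finite_Z by (auto simp: card_gt_0_iff)
    with card_Z have "card ?Z < card Z" by linarith
    moreover have "bit_form ?Z Q"
      using A.two_group_kernel[OF addA] finite_Z
      by (simp add: bit_form_def bit_form_axioms_def add_left sym)
    ultimately obtain n where n: "card ?Z = 4 ^ n * card (radical ?Z Q)"
      using less.hyps[of ?Z] less.prems by auto
    have "radical ?Z Q = radical Z Q"
    proof (intro equalityI subsetI)
      fix x assume x: "x \<in> radical Z Q"
      then show "x \<in> radical ?Z Q" using sym ab by (auto simp: radical_def)
    next
      fix x assume x: "x \<in> radical ?Z Q"
      then have xZ: "x \<in> Z" "Q x a = 0" "Q x b = 0" using sym ab by (auto simp: radical_def)
      have "Q x z = 0" if z: "z \<in> Z" for z
      proof -
        \<comment> \<open>Adding \<open>b\<close> if \<open>Q a z = 1\<close> and \<open>a\<close>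
          if \<open>Q b z = 1\<close> projects \<open>z\<close> to the complement and leaves its
          product with \<open>x\<close> unchanged. The two corrections do not interfere because
          \<open>Q a a = Q b b = 0\<close>.\<close>
        have proj: "Q x y = 0" if "y \<in> Z" "Q a y = 0" "Q b y = 0" for y
          using x that by (auto simp: radical_def)
        show ?thesis
          using proj[of z] proj[of "z + b"] proj[of "z + a"] proj[of "z + (a + b)"]
            z xZ ab ba less.prems(2)[of a] less.prems(2)[of b]
          by (cases "Q a z"; cases "Q b z") (auto simp: add_right add_mem)
      qed
      then show "x \<in> radical Z Q" using xZ by (simp add: radical_def)
    qed
    then show ?thesis using card_Z n by (intro exI[of _ "Suc n"]) simp
  qed
qed

text \<open>The added term vanishes on vectors orthogonal to \<open>w\<close>, and by symmetry the
  radical of \<open>Q\<close> consists of such vectors.\<close>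

lemma (in bit_form) radical_eq_alternating:
  assumes w: "w \<in> Z" "\<And>y. y \<in> Z \<Longrightarrow> Q w y = Q y y"
  defines "B \<equiv> (\<lambda>x y. Q x y + Q w x * Q w y)"
  shows "radical Z Q = {x \<in> radical Z B. Q w x = 0}"
proof -
  {
    fix x assume x: "x \<in> radical Z Q"
    then have "Q w x = 0" using sym[OF w(1), of x] w(1) by (auto simp: radical_def)
    with x have "x \<in> radical Z B" "Q w x = 0" by (simp_all add: radical_def B_def)
  }
  then show ?thesis by (auto simp: radical_def B_def)
qed

text \<open>Adding the square of the diagonal to \<open>Q\<close> makes it alternating, hence of even rank, and
  enlarges the radical by \<open>w\<close> if \<open>Q w w = 1\<close>.\<close>

lemma (in bit_form) card_eq_characteristic:
  assumes w: "w \<in> Z" "\<And>y. y \<in> Z \<Longrightarrow> Q w y = Q y y"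
  shows "\<exists>n. card Z = 4 ^ n * ((if Q w w = 1 then 2 else 1) * card (radical Z Q))"
proof -
  let ?B = "\<lambda>x y. Q x y + Q w x * Q w y"
  interpret B: bit_form Z ?B
    by unfold_locales (auto simp: finite_Z add_left add_right w(1) sym algebra_simps)
  have "?B x x = 0" if "x \<in> Z" for x
    using w(2)[OF that] by (cases "Q x x") simp_all
  then obtain n where n: "card Z = 4 ^ n * card (radical Z ?B)"
    using card_alternating_form[OF B.bit_form_axioms] by blast
  have rad: "radical Z Q = {x \<in> radical Z ?B. Q w x = 0}"
    by (rule radical_eq_alternating[OF w])
  have "card (radical Z ?B) = (if Q w w = 1 then 2 else 1) * card (radical Z Q)"
  proof (cases "Q w w = 1")
    case False
    then have 0: "Q w w = 0" by simp
    \<comment> \<open>With \<open>Q w w = 0\<close> the value \<open>?B x w\<close> reduces to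
      \<open>Q x w\<close>.\<close>
    have "Q w x = 0" if "x \<in> radical Z ?B" for x
    proof -
      have "?B x w = 0" "x \<in> Z" using that w(1) by (auto simp: radical_def)
      then show ?thesis using 0 sym[OF w(1), of x] by auto
    qed
    then have "radical Z Q = radical Z ?B" using rad by blast
    then show ?thesis using 0 by simp
  next
    case 1: True
    interpret R: two_group "radical Z ?B" by (rule B.two_group_radical)
    \<comment> \<open>Here \<open>w\<close> itself lies in the radical of \<open>?B\<close> and is
      not orthogonal to itself, so the condition \<open>Q w x = 0\<close> halves that
      radical.\<close>
    have "card (radical Z ?B) = 2 * card {x \<in> radical Z ?B. Q w x = 0}"
      by (rule R.card_eq_twice_kernel)
        (use 1 w(1) finite_Z additive_right[OF w(1)] in
          \<open>auto simp: radical_def additive_on_def\<close>)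
    then show ?thesis using 1 by (simp flip: rad)
  qed
  with n show ?thesis by auto
qed

text \<open>Where both functionals vanish, the new radical lies in the old one, so none of the four
  joint fibres of \<open>\<alpha>\<close> and \<open>\<beta>\<close> is larger than the old radical.
  A fourfold radical makes all four nonempty. A vector \<open>x\<close> of the new radical with
  \<open>\<alpha> x = 0\<close> and \<open>\<beta> x = 1\<close> represents \<open>\<alpha>\<close>
  through \<open>Q\<close>, whence \<open>\<alpha> w = Q x w = Q x x = \<alpha> x = 0\<close>;
  likewise for \<open>\<beta>\<close>.\<close>

lemma (in bit_form) characteristic_vanishes:
  assumes Q': "bit_form Z Q'" and w: "w \<in> Z" "\<And>y. y \<in> Z \<Longrightarrow> Q w y = Q y y"
    and \<alpha>: "additive_on Z \<alpha>" and \<beta>: "additive_on Z \<beta>"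
    and Q'_eq: "\<And>x y. x \<in> Z \<Longrightarrow> y \<in> Z \<Longrightarrow> Q' x y = Q x y + (\<alpha> x * \<beta> y + \<beta> x * \<alpha> y)"
    and card: "card (radical Z Q') \<ge> 4 * card (radical Z Q)"
  shows "\<alpha> w = 0" "\<beta> w = 0"
proof -
  interpret Q': bit_form Z Q' by fact
  let ?R = "radical Z Q'"
  let ?F = "\<lambda>a b. {x \<in> ?R. \<alpha> x = a \<and> \<beta> x = b}"
  interpret R: two_group ?R by (rule Q'.two_group_radical)
  have finR: "finite ?R" using finite_Z by (simp add: radical_def)
  have pair: "additive_on ?R \<alpha>" "additive_on ?R \<beta>"
    using \<alpha> \<beta> by (auto simp: additive_on_def radical_def)
  have kernel: "?F 0 0 \<subseteq> radical Z Q"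
    using Q'_eq by (auto simp: radical_def)
  have le: "card (?F a b) \<le> card (radical Z Q)" for a b
  proof (cases "?F a b = {}")
    case False
    then obtain p where p: "p \<in> ?R" "\<alpha> p = a" "\<beta> p = b" by auto
    have "(+) p ` ?F a b \<subseteq> ?F 0 0"
      using p pair by (auto simp: additive_onD)
    moreover have "inj_on ((+) p) (?F a b)" by (simp add: inj_on_def)
    ultimately have "card (?F a b) \<le> card (?F 0 0)"
      using finR by (intro card_inj_on_le) auto
    also have "\<dots> \<le> card (radical Z Q)"
      using kernel finite_Z by (intro card_mono) (auto simp: radical_def)
    finally show ?thesis .
  next
    case True
    show ?thesis unfolding True by simp
  qed
  have pos: "card (radical Z Q) > 0"
    using finite_Z by (auto simp: card_gt_0_iff radical_def zero_left)
  have "card ?R = card (?F 0 0 \<union> (?F 0 1 \<union> (?F 1 0 \<union> ?F 1 1)))"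
    by (rule arg_cong[where f = card]) (use bit.exhaust in blast)
  also have "\<dots> \<le> card (?F 0 0) + (card (?F 0 1) + (card (?F 1 0) + card (?F 1 1)))"
    by (intro order_trans[OF card_Un_le] add_mono order_refl)
  finally have "card (?F 0 1) > 0" "card (?F 1 0) > 0"
    using card le[of 0 0] le[of 0 1] le[of 1 0] le[of 1 1] pos by linarith+
  then obtain x y where x: "x \<in> ?R" "\<alpha> x = 0" "\<beta> x = 1" and y: "y \<in> ?R" "\<alpha> y = 1" "\<beta> y = 0"
    by (auto simp: card_gt_0_iff)
  then have Z: "x \<in> Z" "y \<in> Z" by (auto simp: radical_def)
  have "Q x z = \<alpha> z" "Q y z = \<beta> z" if "z \<in> Z" for z
    using Q'_eq[OF Z(1) that] Q'_eq[OF Z(2) that] x y that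
    by (auto simp: radical_def bit_add_eq_0_iff)
  then show "\<alpha> w = 0" "\<beta> w = 0"
    using w(2)[OF Z(1)] w(2)[OF Z(2)] sym[OF Z(1) w(1)] sym[OF Z(2) w(1)] Z w(1) x y by simp_all
qed

section \<open>The crossing form of a ranking of the darts\<close>

text \<open>Edge sets of even degree. The sum runs over darts, so a loop counts twice at its vertex
  and is a cycle by itself.\<close>

definition cycle_space :: "('v, 'e) pre_digraph \<Rightarrow> ('e \<Rightarrow> bit) set" where
  "cycle_space G =
     {x. (\<forall>e. e \<notin> arcs G \<longrightarrow> x e = 0) \<and> (\<forall>v. (\<Sum>d\<in>darts_at G v. x (fst d)) = 0)}"

text \<open>A ranking encodes a rotation system: at each vertex the darts follow one another by
  increasing rank, cyclically.\<close>

definition dart_ranking :: "('v, 'e) pre_digraph \<Rightarrow> ('e dart \<Rightarrow> real) \<Rightarrow> bool" where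
  "dart_ranking G r \<longleftrightarrow>
     (\<forall>a\<in>darts G. \<forall>d\<in>darts G. dart_origin G a = dart_origin G d \<longrightarrow> r a = r d \<longrightarrow> a = d)"

definition before :: "('v, 'e) pre_digraph \<Rightarrow> ('e dart \<Rightarrow> real) \<Rightarrow> ('e dart \<times> 'e dart) set" where
  "before G r =
     {(a, d). a \<in> darts G \<and> d \<in> darts G \<and> dart_origin G a = dart_origin G d \<and> r a < r d}"

definition inversions ::
    "('v, 'e) pre_digraph \<Rightarrow> ('e dart \<Rightarrow> real) \<Rightarrow> ('e dart \<Rightarrow> real) \<Rightarrow> ('e dart \<times> 'e dart) set" where
  "inversions G r r' = {(a, d) \<in> before G r. (d, a) \<in> before G r'}"

text \<open>The number modulo 2 of intersections of \<open>x\<close> with a copy of \<open>y\<close>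
  pushed off to the side before each dart. The first sum counts crossings inside the vertex discs.
  Along an edge of sign 1 the sides lying before its two darts are opposite, so there the curves
  cross once more; along an edge of sign -1 they do not.\<close>

definition crossing_form ::
    "('v, 'e) pre_digraph \<Rightarrow> ('e \<Rightarrow> int) \<Rightarrow> ('e dart \<Rightarrow> real) \<Rightarrow> ('e \<Rightarrow> bit) \<Rightarrow> ('e \<Rightarrow> bit) \<Rightarrow> bit" where
  "crossing_form G \<sigma> r x y =
     (\<Sum>(a, d)\<in>before G r. x (fst a) * y (fst d)) + (\<Sum>e | e \<in> arcs G \<and> \<sigma> e = 1. x e * y e)"

lemma beforeD:
  assumes "(a, d) \<in> before G r"
  shows "a \<in> darts G" "d \<in> darts G" "dart_origin G a = dart_origin G d" "a \<noteq> d"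
    "(d, a) \<notin> before G r"
  using assms by (auto simp: before_def)

lemma before_total:
  assumes "dart_ranking G r" "a \<in> darts G" "d \<in> darts G" "dart_origin G a = dart_origin G d" "a \<noteq> d"
  shows "(a, d) \<in> before G r \<or> (d, a) \<in> before G r"
proof -
  have "r a \<noteq> r d" using assms unfolding dart_ranking_def by blast
  then show ?thesis using assms(2-4) by (simp add: before_def linorder_neq_iff)
qed

lemma finite_bit_functions:
  assumes "finite A"
  shows "finite {x :: 'a \<Rightarrow> bit. \<forall>e. e \<notin> A \<longrightarrow> x e = 0}"
proof -
  have "finite (UNIV :: bit set)"
    by (rule finite_subset[of _ "{0, 1}"]) (use bit.exhaust in auto)
  from finite_set_of_finite_funs[OF assms this, of 0] show ?thesis by simp
qed

lemma two_group_cycle_space: "two_group (cycle_space G)"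
  by unfold_locales (auto simp: cycle_space_def sum.distrib fun_eq_iff)

context fin_digraph
begin

lemma finite_darts [simp]: "finite (darts G)"
  by (simp add: darts_def)

lemma finite_darts_at [simp]: "finite (darts_at G v)"
  by (simp add: darts_at_def)

lemma finite_before [simp]: "finite (before G r)"
  by (rule finite_subset[of _ "darts G \<times> darts G"]) (auto simp: before_def)

lemma finite_inversions [simp]: "finite (inversions G r r')"
  by (rule finite_subset[OF _ finite_before[of r]]) (auto simp: inversions_def)

lemma finite_cycle_space: "finite (cycle_space G)"
  by (rule finite_subset[OF _ finite_bit_functions[OF finite_arcs]]) (auto simp: cycle_space_def)

lemma sum_darts: "(\<Sum>d\<in>darts G. g d) = (\<Sum>e\<in>arcs G. g (e, True) + g (e, False))"
proof -
  have "(\<Sum>d\<in>darts G. g d) = (\<Sum>e\<in>arcs G. \<Sum>b\<in>UNIV. g (e, b))"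
    by (simp add: darts_def sum.cartesian_product)
  then show ?thesis by (simp add: UNIV_bool add.commute)
qed

lemma sum_coincident_darts:
  assumes "x \<in> cycle_space G"
  shows "(\<Sum>(a, d) | a \<in> darts G \<and> d \<in> darts G \<and> dart_origin G a = dart_origin G d.
            x (fst a) * y (fst d)) = 0"
proof -
  have "{(a, d). a \<in> darts G \<and> d \<in> darts G \<and> dart_origin G a = dart_origin G d} =
      prod.swap ` (SIGMA d:darts G. darts_at G (dart_origin G d))"
    by (auto simp: darts_at_def image_iff)
  then have "(\<Sum>(a, d) | a \<in> darts G \<and> d \<in> darts G \<and> dart_origin G a = dart_origin G d.
        x (fst a) * y (fst d)) =
      (\<Sum>(d, a)\<in>(SIGMA d:darts G. darts_at G (dart_origin G d)). x (fst a) * y (fst d))"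
    by (simp add: sum.reindex comp_def case_prod_unfold)
  also have "\<dots> = (\<Sum>d\<in>darts G. (\<Sum>a\<in>darts_at G (dart_origin G d). x (fst a)) * y (fst d))"
    by (subst sum.Sigma[symmetric]) (auto simp: sum_distrib_right)
  also have "\<dots> = 0" using assms by (simp add: cycle_space_def)
  finally show ?thesis .
qed

text \<open>All pairs at a common vertex sum to 0 because \<open>x\<close> has even degrees. They
  split into ordered pairs, reversed pairs and the diagonal, and the diagonal cancels since it meets
  every edge through both of its darts.\<close>

lemma sum_before_swap:
  assumes "dart_ranking G r" "x \<in> cycle_space G"
  shows "(\<Sum>(a, d)\<in>before G r. x (fst a) * y (fst d)) = (\<Sum>(a, d)\<in>before G r. x (fst d) * y (fst a))"
proof -
  let ?f = "\<lambda>(a, d). x (fst a) * y (fst d)"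
  let ?C = "{(a, d). a \<in> darts G \<and> d \<in> darts G \<and> dart_origin G a = dart_origin G d}"
  have C: "?C = before G r \<union> (prod.swap ` before G r \<union> (\<lambda>d. (d, d)) ` darts G)"
    using before_total[OF assms(1)] by (auto simp: image_iff) (auto simp: before_def)
  have "0 = sum ?f ?C" using sum_coincident_darts[OF assms(2)] by simp
  also have "\<dots> = sum ?f (before G r) +
      (sum ?f (prod.swap ` before G r) + sum ?f ((\<lambda>d. (d, d)) ` darts G))"
    unfolding C
    by (subst sum.union_disjoint, simp, simp, force simp: before_def,
        subst sum.union_disjoint, simp, simp) (auto simp: before_def)
  also have "sum ?f ((\<lambda>d. (d, d)) ` darts G) = 0"
    by (subst sum.reindex) (auto simp: inj_on_def sum_darts)
  also have "sum ?f (prod.swap ` before G r) = (\<Sum>(a, d)\<in>before G r. x (fst d) * y (fst a))"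
    by (subst sum.reindex) (auto simp: case_prod_unfold)
  finally show ?thesis by (metis bit_add_eq_0_iff add_0_right)
qed

lemma bit_form_crossing_form:
  assumes "dart_ranking G r"
  shows "bit_form (cycle_space G) (crossing_form G \<sigma> r)"
proof -
  interpret two_group "cycle_space G" by (rule two_group_cycle_space)
  show ?thesis
  proof unfold_locales
    fix x y :: "'b \<Rightarrow> bit"
    assume "x \<in> cycle_space G"
    then show "crossing_form G \<sigma> r x y = crossing_form G \<sigma> r y x"
      by (simp add: crossing_form_def sum_before_swap[OF assms] mult.commute)
  qed (simp_all add: finite_cycle_space crossing_form_def distrib_right sum.distrib
         case_prod_unfold add_ac)
qed

section \<open>The form under a change of the order\<close>

lemma inversions_iff:
  "(a, d) \<in> inversions G r r' \<longleftrightarrow> (a, d) \<in> before G r \<and> (d, a) \<in> before G r'"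
  by (simp add: inversions_def)

lemma inversions_subset: "inversions G r r' \<subseteq> before G r"
  by (auto simp: inversions_def)

lemma before_eq_inversions:
  assumes "dart_ranking G r" "dart_ranking G r'"
  shows "before G r' = (before G r - inversions G r r') \<union> prod.swap ` inversions G r r'"
proof -
  have iff: "(a, d) \<in> before G r' \<longleftrightarrow>
      (a, d) \<in> before G r \<and> (d, a) \<notin> before G r' \<or> (d, a) \<in> before G r \<and> (a, d) \<in> before G r'" for a d
    using before_total[OF assms(1), of a d] before_total[OF assms(2), of a d]
      beforeD[of a d G r] beforeD[of d a G r] beforeD[of a d G r'] by metis
  have swap: "(a, d) \<in> prod.swap ` D \<longleftrightarrow> (d, a) \<in> D" for a d :: "'b dart" and D
    by force
  show ?thesis
  proof (rule set_eqI, clarify)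
    fix a d :: "'b dart"
    show "(a, d) \<in> before G r' \<longleftrightarrow>
        (a, d) \<in> before G r - inversions G r r' \<union> prod.swap ` inversions G r r'"
      unfolding Un_iff Diff_iff swap using iff[of a d] by (simp only: inversions_def) blast
  qed
qed

lemma crossing_form_inversions:
  assumes "dart_ranking G r" "dart_ranking G r'"
  shows "crossing_form G \<sigma> r' x y = crossing_form G \<sigma> r x y +
    (\<Sum>(a, d)\<in>inversions G r r'. x (fst a) * y (fst d) + x (fst d) * y (fst a))"
proof -
  let ?f = "\<lambda>(a, d). x (fst a) * y (fst d)"
  let ?D = "inversions G r r'"
  have "sum ?f (before G r') = sum ?f (before G r - ?D) + sum ?f (prod.swap ` ?D)"
    unfolding before_eq_inversions[OF assms]
    by (rule sum.union_disjoint, simp, simp) (auto simp: before_def inversions_def)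
  also have "sum ?f (prod.swap ` ?D) = (\<Sum>(a, d)\<in>?D. x (fst d) * y (fst a))"
    by (subst sum.reindex) (auto simp: case_prod_unfold)
  also have "sum ?f (before G r - ?D) = sum ?f (before G r) + sum ?f ?D"
    using sum.subset_diff[of ?D "before G r" ?f] by (simp add: inversions_subset add.assoc)
  finally show ?thesis
    by (simp add: crossing_form_def sum.distrib case_prod_unfold add_ac)
qed

text \<open>With equal arguments the two terms of each inverted pair cancel. At a single cycle of
  the graph the common value is 1 exactly if the cycle is negative.\<close>

lemma crossing_form_diagonal:
  assumes "dart_ranking G r" "dart_ranking G r'"
  shows "crossing_form G \<sigma> r' x x = crossing_form G \<sigma> r x x"
  by (simp add: crossing_form_inversions[OF assms] mult.commute case_prod_unfold)

definition between :: "('b dart \<Rightarrow> real) \<Rightarrow> 'b dart \<Rightarrow> real \<Rightarrow> 'b dart set" where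
  "between r t y = {b \<in> darts G. dart_origin G b = dart_origin G t \<and>
     (y < r b \<and> r b < r t \<or> r t < r b \<and> r b < y)}"

lemma finite_between [simp]: "finite (between r t y)"
  by (simp add: between_def)

lemma inversions_move:
  assumes "t \<in> darts G"
  shows "inversions G r (r(t := y)) = (\<lambda>b. if r b < r t then (b, t) else (t, b)) ` between r t y"
proof (intro equalityI subsetI)
  fix p assume "p \<in> inversions G r (r(t := y))"
  then obtain a d where p: "p = (a, d)" "a \<in> darts G" "d \<in> darts G"
      "dart_origin G a = dart_origin G d" "r a < r d" "(r(t := y)) d < (r(t := y)) a"
    unfolding inversions_def before_def by blast
  have "a = t \<and> d \<noteq> t \<or> d = t \<and> a \<noteq> t" using p(5,6) by (cases "a = t"; cases "d = t") simp_all
  then show "p \<in> (\<lambda>b. if r b < r t then (b, t) else (t, b)) ` between r t y"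
  proof (elim disjE conjE)
    assume "a = t" "d \<noteq> t"
    then show ?thesis using p by (intro image_eqI[of _ _ d]) (simp_all add: between_def)
  next
    assume "d = t" "a \<noteq> t"
    then show ?thesis using p by (intro image_eqI[of _ _ a]) (simp_all add: between_def)
  qed
next
  fix p assume "p \<in> (\<lambda>b. if r b < r t then (b, t) else (t, b)) ` between r t y"
  then obtain b where b: "b \<in> between r t y" "p = (if r b < r t then (b, t) else (t, b))" by blast
  then have "b \<noteq> t" by (auto simp: between_def)
  then show "p \<in> inversions G r (r(t := y))"
    using b assms by (cases "r b < r t") (simp_all add: inversions_def before_def between_def)
qed

lemma dart_ranking_move:
  assumes "dart_ranking G r" "y \<notin> r ` darts G"
  shows "dart_ranking G (r(t := y))"
  using assms by (auto simp: dart_ranking_def)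

lemma crossing_form_move:
  assumes "dart_ranking G r" "t \<in> darts G" "y \<notin> r ` darts G"
  shows "crossing_form G \<sigma> (r(t := y)) x z = crossing_form G \<sigma> r x z +
    (x (fst t) * (\<Sum>b\<in>between r t y. z (fst b)) + (\<Sum>b\<in>between r t y. x (fst b)) * z (fst t))"
proof -
  have "b \<noteq> t" if "b \<in> between r t y" for b using that by (auto simp: between_def)
  then have "inj_on (\<lambda>b. if r b < r t then (b, t) else (t, b)) (between r t y)"
    unfolding inj_on_def by (metis prod.inject)
  then have "(\<Sum>(a, d)\<in>inversions G r (r(t := y)). x (fst a) * z (fst d) + x (fst d) * z (fst a)) =
      (\<Sum>b\<in>between r t y. x (fst t) * z (fst b) + x (fst b) * z (fst t))"
    unfolding inversions_move[OF assms(2)]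
    by (simp only: sum.reindex comp_def) (auto intro!: sum.cong simp: add.commute)
  also have "\<dots> = x (fst t) * (\<Sum>b\<in>between r t y. z (fst b)) + (\<Sum>b\<in>between r t y. x (fst b)) * z (fst t)"
    by (simp add: sum.distrib sum_distrib_left sum_distrib_right)
  finally show ?thesis
    using crossing_form_inversions[OF assms(1) dart_ranking_move[OF assms(1,3)], of \<sigma> t x z] by simp
qed

text \<open>The measure of progress: a reordering that inverts only pairs which have to be inverted
  anyway creates no new disagreement with \<open>r'\<close> and settles at least one.\<close>

lemma inversions_psubset:
  assumes "dart_ranking G r" "dart_ranking G r'"
    and "inversions G r q \<subseteq> inversions G r r'" "inversions G r q \<noteq> {}"
  shows "inversions G q r' \<subset> inversions G r r'"
proof
  show "inversions G q r' \<subseteq> inversions G r r'"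
  proof clarify
    fix a d :: "'b dart"
    assume "(a, d) \<in> inversions G q r'"
    then have q: "(a, d) \<in> before G q" and r': "(d, a) \<in> before G r'" by (simp_all add: inversions_iff)
    have "(d, a) \<notin> before G r"
    proof
      assume "(d, a) \<in> before G r"
      with q have "(d, a) \<in> inversions G r r'" using assms(3) by (metis inversions_iff subsetD)
      then show False using beforeD(5)[OF r'] by (simp add: inversions_iff)
    qed
    then show "(a, d) \<in> inversions G r r'"
      using r' before_total[OF assms(1) beforeD(1-4)[OF q]] by (simp add: inversions_iff)
  qed
  obtain a d where ad: "(a, d) \<in> inversions G r q" using assms(4) by auto
  then have "(a, d) \<notin> inversions G q r'" using beforeD(5)[of d a G q] by (simp add: inversions_iff)
  with ad assms(3) show "inversions G q r' \<noteq> inversions G r r'" by blast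
qed

end

section \<open>Moves towards a ranking of the other parity\<close>

lemma finite_isolated:
  fixes c :: real
  assumes "finite A"
  shows "\<exists>\<epsilon>>0. \<forall>a\<in>A. a \<noteq> c \<longrightarrow> \<epsilon> < \<bar>a - c\<bar>"
  using assms
proof (induction A rule: finite_induct)
  case empty
  show ?case by (intro exI[of _ 1]) simp
next
  case (insert b A)
  then obtain \<epsilon> where "\<epsilon> > 0" "\<forall>a\<in>A. a \<noteq> c \<longrightarrow> \<epsilon> < \<bar>a - c\<bar>" by blast
  then show ?case
    by (intro exI[of _ "if b = c then \<epsilon> else min \<epsilon> (\<bar>b - c\<bar> / 2)"]) (auto simp: min_less_iff_disj)
qed

context fin_digraph
begin

text \<open>Here \<open>f\<close> stands for the number of faces and \<open>K\<close> for a factor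
  common to all rankings, so two more faces mean a radical four times as large.\<close>

lemma optimal_move:
  fixes f :: "('b dart \<Rightarrow> real) \<Rightarrow> nat"
  assumes f: "\<And>q. dart_ranking G q \<Longrightarrow>
      K * card (radical (cycle_space G) (crossing_form G \<sigma> q)) = 2 ^ f q"
    and r: "dart_ranking G r" and y: "t \<in> darts G" "y \<notin> r ` darts G"
    and f_move: "f r + 2 \<le> f (r(t := y))"
    and w: "w \<in> cycle_space G"
      "\<And>z. z \<in> cycle_space G \<Longrightarrow> crossing_form G \<sigma> r w z = crossing_form G \<sigma> r z z"
  shows "w (fst t) = 0" "(\<Sum>b\<in>between r t y. w (fst b)) = 0"
proof -
  let ?q = "r(t := y)"
  have q: "dart_ranking G ?q" by (rule dart_ranking_move[OF r y(2)])
  interpret bit_form "cycle_space G" "crossing_form G \<sigma> r" by (rule bit_form_crossing_form[OF r])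
  have "K > 0" using f[OF r] by (cases K) simp_all
  moreover have "4 * 2 ^ f r \<le> (2::nat) ^ f ?q"
    using power_increasing[OF f_move, of "2::nat"] by (simp add: mult.commute)
  ultimately have "4 * card (radical (cycle_space G) (crossing_form G \<sigma> r))
      \<le> card (radical (cycle_space G) (crossing_form G \<sigma> ?q))"
    unfolding f[OF r, symmetric] f[OF q, symmetric] by simp
  then show "w (fst t) = 0" "(\<Sum>b\<in>between r t y. w (fst b)) = 0"
    using characteristic_vanishes[OF bit_form_crossing_form[OF q] w, where \<alpha> = "\<lambda>x. x (fst t)"
        and \<beta> = "\<lambda>x. \<Sum>b\<in>between r t y. x (fst b)"] crossing_form_move[OF r y]
    by (simp_all add: additive_on_def sum.distrib)
qed

text \<open>The argument moves the dart \<open>t\<close> to just beyond \<open>s\<close> and to just before \<open>s\<close>.\<close>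

lemma characteristic_zero_at_inversion:
  assumes r: "dart_ranking G r"
    and move: "\<And>t y. t \<in> darts G \<Longrightarrow> y \<notin> r ` darts G \<Longrightarrow>
      inversions G r (r(t := y)) \<subseteq> inversions G r r' \<Longrightarrow> between r t y \<noteq> {} \<Longrightarrow>
      (\<Sum>b\<in>between r t y. w (fst b)) = (0 :: bit)"
    and ts: "t \<in> darts G" "s \<in> darts G" "dart_origin G t = dart_origin G s" "t \<noteq> s"
    and inv: "\<And>b. b \<in> insert s (between r t (r s)) \<Longrightarrow>
      (t, b) \<in> inversions G r r' \<or> (b, t) \<in> inversions G r r'"
  shows "w (fst s) = 0"
proof -
  have rts: "r t \<noteq> r s" using r ts unfolding dart_ranking_def by blast
  obtain \<epsilon> where \<epsilon>: "\<epsilon> > 0" "\<And>b. b \<in> darts G \<Longrightarrow> r b \<noteq> r s \<Longrightarrow> \<epsilon> < \<bar>r b - r s\<bar>"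
    using finite_isolated[of "r ` darts G" "r s"] by auto
  have eq_s: "b = s" if "b \<in> darts G" "dart_origin G b = dart_origin G t" "r b = r s" for b
    using r ts(2,3) that unfolding dart_ranking_def by metis
  \<comment> \<open>\<open>u\<close> is the direction from \<open>t\<close> to \<open>s\<close>. The
    target \<open>y\<close> overshoots \<open>s\<close> and \<open>y'\<close> stops short of it,
    with no rank other than that of \<open>s\<close> in between.\<close>
  define u where "u = (if r t < r s then 1 else - 1 :: real)"
  define y where "y = r s + u * \<epsilon>"
  define y' where "y' = r s - u * \<epsilon>"
  have gap: "r b < r s - \<epsilon> \<or> r b = r s \<or> r b > r s + \<epsilon>" if "b \<in> darts G" for b
    using \<epsilon>(2)[OF that] by (cases "r b = r s") (auto simp: abs_if split: if_splits)
  have "r b \<noteq> y \<and> r b \<noteq> y'" if "b \<in> darts G" for b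
    using gap[OF that] \<epsilon>(1) by (auto simp: y_def y'_def u_def)
  then have y_notin: "y \<notin> r ` darts G" "y' \<notin> r ` darts G" by blast+
  have B: "between r t y = insert s (between r t (r s))"
  proof (intro equalityI subsetI)
    fix b assume b: "b \<in> between r t y"
    then have bD: "b \<in> darts G" "dart_origin G b = dart_origin G t" by (simp_all add: between_def)
    show "b \<in> insert s (between r t (r s))"
      using b gap[OF bD(1)] gap[OF ts(1)] eq_s[OF bD] bD \<epsilon>(1) rts
      by (cases "r t < r s") (auto simp: between_def y_def u_def)
  next
    fix b assume "b \<in> insert s (between r t (r s))"
    then show "b \<in> between r t y"
      using ts \<epsilon>(1) rts by (cases "r t < r s") (auto simp: between_def y_def u_def)
  qed
  have B': "between r t y' = between r t (r s)"
  proof (intro equalityI subsetI)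
    fix b assume b: "b \<in> between r t y'"
    show "b \<in> between r t (r s)"
      using b gap[OF ts(1)] \<epsilon>(1) rts by (cases "r t < r s") (auto simp: between_def y'_def u_def)
  next
    fix b assume b: "b \<in> between r t (r s)"
    then have bD: "b \<in> darts G" by (simp add: between_def)
    show "b \<in> between r t y'"
      using b gap[OF bD] gap[OF ts(1)] \<epsilon>(1) rts
      by (cases "r t < r s") (auto simp: between_def y'_def u_def)
  qed
  have sub: "inversions G r (r(t := z)) \<subseteq> inversions G r r'"
    if z: "between r t z \<subseteq> insert s (between r t (r s))" for z
  proof -
    have "(if r b < r t then (b, t) else (t, b)) \<in> inversions G r r'" if "b \<in> between r t z" for b
      using inv[of b] z that by (auto simp: inversions_iff before_def)
    then show ?thesis unfolding inversions_move[OF ts(1)] by blast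
  qed
  have "(\<Sum>b\<in>between r t y. w (fst b)) = 0"
    by (rule move[OF ts(1) y_notin(1) sub]) (simp_all add: B)
  \<comment> \<open>The second move passes the same block without \<open>s\<close>, so the two sums
    differ by \<open>w (fst s)\<close>. If the block is empty, \<open>move\<close> does not apply,
    but the sum is 0 anyway.\<close>
  moreover have "(\<Sum>b\<in>between r t (r s). w (fst b)) = 0"
  proof (cases "between r t (r s) = {}")
    case False
    have "(\<Sum>b\<in>between r t y'. w (fst b)) = 0"
      by (rule move[OF ts(1) y_notin(2) sub]) (use False in \<open>auto simp: B'\<close>)
    then show ?thesis by (simp add: B')
  qed simp
  moreover have "s \<notin> between r t (r s)" by (simp add: between_def)
  ultimately show ?thesis by (simp add: B)
qed

lemma exists_next_ranking:
  fixes f :: "('b dart \<Rightarrow> real) \<Rightarrow> nat"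
  assumes f: "\<And>q. dart_ranking G q \<Longrightarrow>
      K * card (radical (cycle_space G) (crossing_form G \<sigma> q)) = 2 ^ f q"
    and p: "dart_ranking G p" and p_min: "\<And>q. dart_ranking G q \<Longrightarrow> f p \<le> f q"
    and p': "dart_ranking G p'" "odd (f p + f p')"
  shows "\<exists>q. dart_ranking G q \<and> f q = f p + 1"
proof (rule ccontr)
  assume no: "\<nexists>q. dart_ranking G q \<and> f q = f p + 1"
  \<comment> \<open>Both members of the pair vary: the first keeps the least number of faces, the
    second only the other parity.\<close>
  let ?P = "\<lambda>(r, r'). dart_ranking G r \<and> dart_ranking G r' \<and> f r = f p \<and> odd (f p + f r')"
  obtain m where m: "?P m" "\<And>m'. ?P m' \<Longrightarrow>
      card (case_prod (inversions G) m) \<le> card (case_prod (inversions G) m')"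
    using ex_has_least_nat[of ?P "(p, p')" "\<lambda>m. card (case_prod (inversions G) m)"] p p' by auto
  obtain r r' where m_eq: "m = (r, r')" by force
  from m(1) have r: "dart_ranking G r" and r': "dart_ranking G r'" and fr: "f r = f p"
    and odd: "odd (f p + f r')" unfolding m_eq by simp_all
  have closest: "card (inversions G r r') \<le> card (inversions G q r')"
    if "dart_ranking G q" "f q = f p" for q
    using m(2)[of "(q, r')"] that r' fr odd by (simp add: m_eq)
  interpret R: bit_form "cycle_space G" "crossing_form G \<sigma> r" by (rule bit_form_crossing_form[OF r])
  interpret R': bit_form "cycle_space G" "crossing_form G \<sigma> r'" by (rule bit_form_crossing_form[OF r'])
  obtain w where w: "w \<in> cycle_space G"
    "\<And>z. z \<in> cycle_space G \<Longrightarrow> crossing_form G \<sigma> r w z = crossing_form G \<sigma> r z z"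
    using R.exists_characteristic by blast
  have move: "(\<Sum>b\<in>between r t y. w (fst b)) = 0"
    if t: "t \<in> darts G" "y \<notin> r ` darts G" "inversions G r (r(t := y)) \<subseteq> inversions G r r'"
      "between r t y \<noteq> {}" for t y
  proof (rule optimal_move(2)[OF f r t(1,2) _ w])
    have q: "dart_ranking G (r(t := y))" by (rule dart_ranking_move[OF r t(2)])
    have "inversions G (r(t := y)) r' \<subset> inversions G r r'"
      by (rule inversions_psubset[OF r r' t(3)]) (simp only: inversions_move[OF t(1)] image_is_empty t(4) not_False_eq_True)
    then have "card (inversions G (r(t := y)) r') < card (inversions G r r')"
      by (rule psubset_card_mono[OF finite_inversions])
    then have "f (r(t := y)) \<noteq> f p" using closest[OF q] by linarith
    \<comment> \<open>Fewer faces contradict \<open>p_min\<close>, equally many the choice of a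
      closest pair, and one more the assumption \<open>no\<close>.\<close>
    then show "f r + 2 \<le> f (r(t := y))"
      using p_min[OF q] no q fr by (metis Suc_eq_plus1 add_2_eq_Suc' le_SucE le_antisym not_less_eq_eq)
  qed
  have zero: "w (fst a) = 0 \<and> w (fst d) = 0" if ad: "(a, d) \<in> inversions G r r'" for a d
  proof
    \<comment> \<open>\<open>t\<close> is the lowest dart above \<open>a\<close> that
      \<open>r'\<close> places below \<open>a\<close>. A dart between \<open>a\<close> and
      \<open>t\<close> stays above \<open>a\<close> in \<open>r'\<close>, hence above
      \<open>t\<close>, so \<open>t\<close> has to pass it as well. Moving \<open>t\<close> down
      past \<open>a\<close> thus inverts only pairs that have to be inverted.\<close>
    let ?D = "{b \<in> darts G. (a, b) \<in> inversions G r r'}"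
    have fin: "finite ?D" by simp
    have "d \<in> ?D" using ad beforeD(2)[of a d G r] by (simp add: inversions_iff)
    with fin obtain t where t: "t \<in> ?D" "\<And>b. b \<in> ?D \<Longrightarrow> r t \<le> r b"
      using ex_is_arg_min_if_finite[of ?D r] unfolding is_arg_min_linorder by blast
    then have at: "(a, t) \<in> before G r" "(t, a) \<in> before G r'" by (simp_all add: inversions_iff)
    show "w (fst a) = 0"
    proof (rule characteristic_zero_at_inversion[OF r move])
      show "t \<in> darts G" "a \<in> darts G" "dart_origin G t = dart_origin G a" "t \<noteq> a"
        using beforeD[OF at(2)] by simp_all
      fix b assume b: "b \<in> insert a (between r t (r a))"
      show "(t, b) \<in> inversions G r r' \<or> (b, t) \<in> inversions G r r'"
      proof (cases "b = a")
        case False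
        with b at(1) have ab: "(a, b) \<in> before G r" and bt: "(b, t) \<in> before G r"
          unfolding between_def before_def by auto
        then have "(a, b) \<notin> inversions G r r'"
          using t(2)[of b] by (force simp: before_def)
        then have "(a, b) \<in> before G r'"
          using ab before_total[OF r' beforeD(1-4)[OF ab]] by (simp add: inversions_iff)
        with at(2) have "(t, b) \<in> before G r'" by (simp add: before_def)
        with bt show ?thesis by (simp add: inversions_iff)
      qed (use at in \<open>simp add: inversions_iff\<close>)
    qed
  next
    \<comment> \<open>The mirror image: \<open>t\<close> is the highest dart below \<open>d\<close>
      that \<open>r'\<close> places above \<open>d\<close>, and it moves upwards.\<close>
    let ?D = "{b \<in> darts G. (b, d) \<in> inversions G r r'}"
    have fin: "finite ?D" by simp
    have "a \<in> ?D" using ad beforeD(1)[of a d G r] by (simp add: inversions_iff)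
    with fin obtain t where t: "t \<in> ?D" "\<And>b. b \<in> ?D \<Longrightarrow> - r t \<le> - r b"
      using ex_is_arg_min_if_finite[of ?D "\<lambda>b. - r b"] unfolding is_arg_min_linorder by blast
    then have td: "(t, d) \<in> before G r" "(d, t) \<in> before G r'" by (simp_all add: inversions_iff)
    show "w (fst d) = 0"
    proof (rule characteristic_zero_at_inversion[OF r move])
      show "t \<in> darts G" "d \<in> darts G" "dart_origin G t = dart_origin G d" "t \<noteq> d"
        using beforeD[OF td(1)] by simp_all
      fix b assume b: "b \<in> insert d (between r t (r d))"
      show "(t, b) \<in> inversions G r r' \<or> (b, t) \<in> inversions G r r'"
      proof (cases "b = d")
        case False
        with b td(1) have bd: "(b, d) \<in> before G r" and tb: "(t, b) \<in> before G r"
          unfolding between_def before_def by auto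
        then have "(b, d) \<notin> inversions G r r'"
          using t(2)[of b] by (force simp: before_def)
        then have "(b, d) \<in> before G r'"
          using bd before_total[OF r' beforeD(1-4)[OF bd]] by (simp add: inversions_iff)
        with td(2) have "(b, t) \<in> before G r'" by (simp add: before_def)
        with tb show ?thesis by (simp add: inversions_iff)
      qed (use td in \<open>simp add: inversions_iff\<close>)
    qed
  qed
  \<comment> \<open>Every term of the difference of the two forms contains \<open>w\<close> at an
    inverted dart.\<close>
  have "crossing_form G \<sigma> r' w z = crossing_form G \<sigma> r' z z" if "z \<in> cycle_space G" for z
  proof -
    have "(\<Sum>(a, d)\<in>inversions G r r'. w (fst a) * z (fst d) + w (fst d) * z (fst a)) = 0"
      using zero by (intro sum.neutral) auto
    then show ?thesis
      using w(2)[OF that] by (simp add: crossing_form_inversions[OF r r'] crossing_form_diagonal[OF r r'])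
  qed
  then obtain n' where n': "card (cycle_space G) = 4 ^ n' * ((if crossing_form G \<sigma> r' w w = 1 then 2 else 1) *
      card (radical (cycle_space G) (crossing_form G \<sigma> r')))"
    using R'.card_eq_characteristic[OF w(1)] by blast
  obtain n where n: "card (cycle_space G) = 4 ^ n * ((if crossing_form G \<sigma> r w w = 1 then 2 else 1) *
      card (radical (cycle_space G) (crossing_form G \<sigma> r)))"
    using R.card_eq_characteristic[OF w] by blast
  \<comment> \<open>The diagonals agree at \<open>w\<close>, so the factors 1 or 2 cancel; what
    remains is a quotient of radicals that is a power of 4.\<close>
  have "4 ^ n * card (radical (cycle_space G) (crossing_form G \<sigma> r)) =
      4 ^ n' * card (radical (cycle_space G) (crossing_form G \<sigma> r'))"
    using n n' by (simp add: crossing_form_diagonal[OF r r'] split: if_splits)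
  then have "4 ^ n * (K * card (radical (cycle_space G) (crossing_form G \<sigma> r))) =
      4 ^ n' * (K * card (radical (cycle_space G) (crossing_form G \<sigma> r')))"
    by (metis mult.left_commute)
  then have "4 ^ n * (2::nat) ^ f r = 4 ^ n' * 2 ^ f r'" by (simp add: f[OF r] f[OF r'])
  then have "(2::nat) ^ (2 * n + f r) = 2 ^ (2 * n' + f r')" by (simp add: power_add power_mult)
  then have "2 * n + f r = 2 * n' + f r'" by simp
  then have "even (2 * n + f r) \<longleftrightarrow> even (2 * n' + f r')" by (rule arg_cong)
  then have "even (f p + f r')" unfolding fr by simp
  with odd show False by simp
qed

end

section \<open>Counting faces\<close>

text \<open>The sets \<open>P x\<close> partition \<open>S\<close>, and the closed sets are the
  unions of blocks. This turns a number of classes into the size of a group over GF(2).\<close>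

lemma card_saturated_sets:
  fixes P :: "'a \<Rightarrow> 'a set"
  assumes "finite S" "\<And>x. x \<in> S \<Longrightarrow> x \<in> P x" "\<And>x. x \<in> S \<Longrightarrow> P x \<subseteq> S"
    and "\<And>x y. x \<in> S \<Longrightarrow> y \<in> P x \<Longrightarrow> P y = P x"
  shows "card {A. A \<subseteq> S \<and> (\<forall>x\<in>A. P x \<subseteq> A)} = 2 ^ card (P ` S)"
proof -
  have "bij_betw Union (Pow (P ` S)) {A. A \<subseteq> S \<and> (\<forall>x\<in>A. P x \<subseteq> A)}"
  proof (rule bij_betw_byWitness[where f' = "\<lambda>A. {B \<in> P ` S. B \<subseteq> A}"])
    show "\<forall>\<A>\<in>Pow (P ` S). {B \<in> P ` S. B \<subseteq> \<Union>\<A>} = \<A>"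
    proof (intro ballI equalityI subsetI)
      fix \<A> B assume \<A>: "\<A> \<in> Pow (P ` S)" and B: "B \<in> {B \<in> P ` S. B \<subseteq> \<Union>\<A>}"
      then obtain x where x: "B = P x" "x \<in> S" by (auto elim: imageE)
      have "x \<in> \<Union>\<A>" using B x assms(2)[OF x(2)] by auto
      then obtain C where C: "C \<in> \<A>" "x \<in> C" by (rule UnionE)
      moreover from this \<A> obtain y where "C = P y" "y \<in> S" by (auto elim: imageE)
      ultimately show "B \<in> \<A>" using assms(4)[of y x] x by simp
    qed auto
    show "\<forall>A\<in>{A. A \<subseteq> S \<and> (\<forall>x\<in>A. P x \<subseteq> A)}. \<Union>{B \<in> P ` S. B \<subseteq> A} = A"
    proof (intro ballI equalityI subsetI)
      fix A x assume "A \<in> {A. A \<subseteq> S \<and> (\<forall>x\<in>A. P x \<subseteq> A)}" "x \<in> A"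
      then have "x \<in> P x" "P x \<in> {B \<in> P ` S. B \<subseteq> A}" using assms(2) by auto
      then show "x \<in> \<Union>{B \<in> P ` S. B \<subseteq> A}" by blast
    qed auto
    show "Union ` Pow (P ` S) \<subseteq> {A. A \<subseteq> S \<and> (\<forall>x\<in>A. P x \<subseteq> A)}"
    proof clarify
      fix \<A> assume \<A>: "\<A> \<subseteq> P ` S"
      have "P x \<subseteq> \<Union>\<A>" if "x \<in> \<Union>\<A>" for x
      proof -
        from that obtain C where C: "C \<in> \<A>" "x \<in> C" by (rule UnionE)
        moreover from this \<A> obtain y where "C = P y" "y \<in> S" by (auto elim: imageE)
        ultimately show ?thesis using assms(4)[of y x] by auto
      qed
      moreover have "\<Union>\<A> \<subseteq> S" using \<A> assms(3) by (auto dest!: subsetD elim!: imageE)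
      ultimately show "\<Union>\<A> \<subseteq> S \<and> (\<forall>x\<in>\<Union>\<A>. P x \<subseteq> \<Union>\<A>)" by auto
    qed
    show "(\<lambda>A. {B \<in> P ` S. B \<subseteq> A}) ` {A. A \<subseteq> S \<and> (\<forall>x\<in>A. P x \<subseteq> A)} \<subseteq> Pow (P ` S)" by blast
  qed
  then show ?thesis
    using bij_betw_same_card card_Pow[of "P ` S"] assms(1) by fastforce
qed

text \<open>By the last hypothesis \<open>\<rho>\<close> conjugates \<open>\<phi>\<close> into its
  inverse, so it carries orbits to orbits, and an orbit together with its reverse is a block of a
  partition.\<close>

lemma card_orbit_pairs:
  fixes \<phi> \<rho> :: "'a \<Rightarrow> 'a"
  assumes S: "finite S" "\<And>x. x \<in> S \<Longrightarrow> \<phi> x \<in> S" "\<And>x. x \<in> S \<Longrightarrow> \<rho> x \<in> S"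
    and \<rho>\<rho>: "\<And>x. x \<in> S \<Longrightarrow> \<rho> (\<rho> x) = x"
    and \<phi>\<rho>\<phi>: "\<And>x. x \<in> S \<Longrightarrow> \<phi> (\<rho> (\<phi> x)) = \<rho> x"
  shows "card {A. A \<subseteq> S \<and> (\<forall>x\<in>A. \<phi> x \<in> A \<and> \<rho> x \<in> A)} =
    2 ^ card ((\<lambda>x. orbit \<phi> x \<union> orbit \<phi> (\<rho> x)) ` S)"
proof -
  let ?F = "\<lambda>x. orbit \<phi> x \<union> orbit \<phi> (\<rho> x)"
  have "inj_on \<phi> S" by (metis \<phi>\<rho>\<phi> \<rho>\<rho> inj_onI)
  then have bij: "bij_betw \<phi> S S"
    using S(1,2) by (simp add: bij_betw_def endo_inj_surj image_subsetI)
  have orb_S: "y \<in> S" if "y \<in> orbit \<phi> x" "x \<in> S" for x y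
    using that by (induction rule: orbit.induct) (auto simp: S)
  have self: "x \<in> orbit \<phi> x" if "x \<in> S" for x
  proof -
    \<comment> \<open>An \<open>orbit\<close> begins with the image of its starting point, so
      \<open>x\<close> lies in its own only by periodicity. Since \<open>\<phi>\<close> need only
      permute \<open>S\<close>, it is extended by the identity.\<close>
    let ?\<psi> = "\<lambda>x. if x \<in> S then \<phi> x else x"
    have "bij_betw ?\<psi> S S" using bij by (simp cong: bij_betw_cong)
    then have "?\<psi> permutes S" by (rule bij_imp_permutes) simp
    then have "x \<in> orbit ?\<psi> x"
      using S(1) by (intro permutation_self_in_orbit) (auto simp: permutation_permutes)
    also have "orbit ?\<psi> x = orbit \<phi> x"
      by (rule orbit_cong0[OF that]) (auto simp: S)
    finally show ?thesis .
  qed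
  have orb_eq: "orbit \<phi> y = orbit \<phi> x" if "y \<in> orbit \<phi> x" "x \<in> S" for x y
    using orbit_trans[of _ \<phi> y x] orbit_trans[of _ \<phi> x y] that(1)
      orbit_swap[OF self[OF that(2)] that(1)] by blast
  have rev: "orbit \<phi> (\<rho> y) = orbit \<phi> (\<rho> x)" if "y \<in> orbit \<phi> x" "x \<in> S" for x y
  proof -
    have step: "orbit \<phi> (\<rho> (\<phi> z)) = orbit \<phi> (\<rho> z)" if "z \<in> S" for z
      using orb_eq[of "\<rho> z" "\<rho> (\<phi> z)"] orbit.base[of \<phi> "\<rho> (\<phi> z)"] that by (simp add: S \<phi>\<rho>\<phi>)
    show ?thesis
      using that by (induction rule: orbit.induct) (simp_all add: step orb_S)
  qed
  have sat: "{A. A \<subseteq> S \<and> (\<forall>x\<in>A. \<phi> x \<in> A \<and> \<rho> x \<in> A)} = {A. A \<subseteq> S \<and> (\<forall>x\<in>A. ?F x \<subseteq> A)}"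
  proof (intro Collect_cong conj_cong refl iffI ballI)
    fix A x assume A: "\<forall>x\<in>A. \<phi> x \<in> A \<and> \<rho> x \<in> A" "x \<in> A"
    have "y \<in> A" if "y \<in> orbit \<phi> z" "z \<in> A" for y z
      using that A(1) by (induction rule: orbit.induct) auto
    then show "?F x \<subseteq> A" using A by blast
  next
    fix A x assume A: "A \<subseteq> S" "\<forall>x\<in>A. ?F x \<subseteq> A" "x \<in> A"
    then have "\<rho> x \<in> orbit \<phi> (\<rho> x)" by (intro self S(3)) auto
    then show "\<phi> x \<in> A \<and> \<rho> x \<in> A" using A orbit.base[of \<phi> x] by auto
  qed
  show ?thesis
    unfolding sat
  proof (rule card_saturated_sets)
    fix x y assume x: "x \<in> S" and y: "y \<in> ?F x"
    then show "?F y = ?F x"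
      using orb_eq[of y x] rev[of y x] orb_eq[of y "\<rho> x"] rev[of y "\<rho> x"] by (auto simp: S \<rho>\<rho>)
  qed (auto simp: S self dest: orb_S)
qed

text \<open>The value of a colouring at \<open>d\<close> is the colour of the corner before \<open>d\<close>. The conditions say
  that the corners on a common side of an edge have the same colour.\<close>

definition corner_colourings ::
    "('v, 'e) pre_digraph \<Rightarrow> ('e \<Rightarrow> int) \<Rightarrow> ('e dart \<Rightarrow> 'e dart) \<Rightarrow> ('e dart \<Rightarrow> bit) set" where
  "corner_colourings G \<sigma> \<pi> = {c. (\<forall>d. d \<notin> darts G \<longrightarrow> c d = 0) \<and>
     (\<forall>d\<in>darts G. c d + c (\<pi> d) = c (dart_rev d) + c (\<pi> (dart_rev d)) \<and>
        c d + c (dart_rev d) = (if \<sigma> (fst d) = 1 then c d + c (\<pi> d) else 0))}"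

lemma dart_rev_in_darts [simp]: "dart_rev d \<in> darts G \<longleftrightarrow> d \<in> darts G"
  by (cases d) (simp add: darts_def dart_rev_def)

lemma dart_rev_rev [simp]: "dart_rev (dart_rev d) = d"
  and fst_dart_rev [simp]: "fst (dart_rev d) = fst d"
  by (simp_all add: dart_rev_def)

context signed_graph
begin

text \<open>A state \<open>(d, 1)\<close> belongs to the corner before \<open>d\<close>, a state
  \<open>(d, -1)\<close> to the corner after \<open>d\<close>, which is the one before
  \<open>\<pi> d\<close>. Under this dictionary unions of faces become corner colourings.\<close>

lemma card_corner_colourings:
  assumes \<pi>: "\<pi> permutes darts G"
  shows "card (corner_colourings G \<sigma> \<pi>) = 2 ^ card (faces G \<sigma> \<pi>)"
proof -
  let ?S = "darts G \<times> {1, -1 :: int}"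
  let ?\<phi> = "face_step \<sigma> \<pi>" and ?\<rho> = "state_rev \<sigma>"
  let ?I = "{A. A \<subseteq> ?S \<and> (\<forall>x\<in>A. ?\<phi> x \<in> A \<and> ?\<rho> x \<in> A)}"
  have sgn: "\<sigma> (fst d) = 1 \<or> \<sigma> (fst d) = -1" if "d \<in> darts G" for d
    using that sign[of "fst d"] by (auto simp: darts_def)
  have \<pi>_in: "\<pi> d \<in> darts G \<longleftrightarrow> d \<in> darts G" and inv_in: "inv \<pi> d \<in> darts G \<longleftrightarrow> d \<in> darts G"
    and \<pi>_inv: "\<pi> (inv \<pi> d) = d" "inv \<pi> (\<pi> d) = d" for d
    using \<pi> permutes_inv[OF \<pi>] by (simp_all add: permutes_in_image permutes_inverses)
  have fin: "finite ?S" by simp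
  have \<phi>S: "?\<phi> x \<in> ?S" and \<rho>S: "?\<rho> x \<in> ?S" and \<rho>\<rho>: "?\<rho> (?\<rho> x) = x"
    and \<phi>\<rho>\<phi>: "?\<phi> (?\<rho> (?\<phi> x)) = ?\<rho> x" if x: "x \<in> ?S" for x
  proof -
    obtain d s where x_eq: "x = (d, s)" by (rule prod.exhaust)
    have d: "d \<in> darts G" and s: "s = 1 \<or> s = -1" using x by (auto simp: x_eq)
    let ?t = "s * \<sigma> (fst d)"
    let ?e = "(if ?t = 1 then \<pi> else inv \<pi>) (dart_rev d)"
    have t: "?t = 1 \<or> ?t = -1" using s sgn[OF d] by auto
    have e: "?e \<in> darts G" using d by (simp add: \<pi>_in inv_in)
    have \<phi>: "?\<phi> x = (?e, ?t)" by (simp add: x_eq face_step_def Let_def)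
    have \<rho>: "?\<rho> x = (dart_rev d, - ?t)" by (simp add: x_eq state_rev_def)
    show "?\<phi> x \<in> ?S" using e t by (simp add: \<phi>)
    show "?\<rho> x \<in> ?S" using d t by (auto simp: \<rho>)
    show "?\<rho> (?\<rho> x) = x" using sgn[OF d] by (auto simp: x_eq state_rev_def)
    have "?\<phi> (dart_rev ?e, - (?t * \<sigma> (fst ?e))) = (dart_rev d, - ?t)"
      using t sgn[OF e] by (auto simp: face_step_def Let_def \<pi>_inv)
    moreover have "?\<rho> (?e, ?t) = (dart_rev ?e, - (?t * \<sigma> (fst ?e)))" by (simp add: state_rev_def)
    ultimately show "?\<phi> (?\<rho> (?\<phi> x)) = ?\<rho> x" by (simp only: \<phi> \<rho>)
  qed
  let ?c = "\<lambda>A d. of_bool ((d, 1) \<in> A) :: bit"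
  let ?A = "\<lambda>c :: 'e dart \<Rightarrow> bit. {x \<in> ?S. (if snd x = 1 then c (fst x) else c (\<pi> (fst x))) = 1}"
  have inv: "(d, -1) \<in> A \<longleftrightarrow> (\<pi> d, 1) \<in> A" "(d, s) \<in> A \<longleftrightarrow> (dart_rev d, - (s * \<sigma> (fst d))) \<in> A"
    if A: "A \<in> ?I" and d: "d \<in> darts G" "s = 1 \<or> s = -1" for A d s
  proof -
    have \<rho>_iff: "?\<rho> x \<in> A \<longleftrightarrow> x \<in> A" if "x \<in> ?S" for x
      using A \<rho>\<rho>[OF that] by (metis (mono_tags, lifting) mem_Collect_eq)
    have \<phi>_iff: "?\<phi> x \<in> A \<longleftrightarrow> x \<in> A" if "x \<in> ?S" for x
      using A \<phi>\<rho>\<phi>[OF that] \<rho>_iff[OF that] by (metis (mono_tags, lifting) mem_Collect_eq)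
    show "(d, s) \<in> A \<longleftrightarrow> (dart_rev d, - (s * \<sigma> (fst d))) \<in> A"
      using \<rho>_iff[of "(d, s)"] d by (auto simp: state_rev_def)
    \<comment> \<open>This state reverses to \<open>(d, -1)\<close> and is followed by
      \<open>(\<pi> d, 1)\<close>, because a sign has square 1.\<close>
    have "(dart_rev d, \<sigma> (fst d)) \<in> ?S" using d sgn[OF d(1)] by auto
    from \<rho>_iff[OF this] \<phi>_iff[OF this] show "(d, -1) \<in> A \<longleftrightarrow> (\<pi> d, 1) \<in> A"
      using sgn[OF d(1)] by (auto simp: state_rev_def face_step_def Let_def)
  qed
  have "bij_betw ?c ?I (corner_colourings G \<sigma> \<pi>)"
  proof (rule bij_betw_byWitness[where f' = ?A])
    show "\<forall>A\<in>?I. ?A (?c A) = A"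
    proof
      fix A assume A: "A \<in> ?I"
      show "?A (?c A) = A"
      proof (intro set_eqI)
        fix x :: "'e dart \<times> int"
        obtain d s where x: "x = (d, s)" by (rule prod.exhaust)
        show "x \<in> ?A (?c A) \<longleftrightarrow> x \<in> A"
        proof (cases "x \<in> ?S")
          case True
          then have "d \<in> darts G" "s = 1 \<or> s = -1" by (auto simp: x)
          then show ?thesis using inv(1)[OF A, of d s] by (auto simp: x)
        qed (use A in blast)
      qed
    qed
    show "\<forall>c\<in>corner_colourings G \<sigma> \<pi>. ?c (?A c) = c"
      by (auto simp: corner_colourings_def fun_eq_iff of_bool_def)
    show "?c ` ?I \<subseteq> corner_colourings G \<sigma> \<pi>"
    proof (rule image_subsetI)
      fix A assume A: "A \<in> ?I"
      have eqs: "?c A d + ?c A (\<pi> d) = ?c A (dart_rev d) + ?c A (\<pi> (dart_rev d)) \<and>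
          ?c A d + ?c A (dart_rev d) = (if \<sigma> (fst d) = 1 then ?c A d + ?c A (\<pi> d) else 0)"
        if d: "d \<in> darts G" for d
        using inv(1)[OF A d, of 1] inv(1)[OF A, of "dart_rev d" 1] inv(2)[OF A d, of 1]
          inv(2)[OF A d, of "-1"] sgn[OF d] d
        by (elim disjE) (simp_all add: add.commute)
      have zero: "?c A d = 0" if "d \<notin> darts G" for d using A that by auto
      show "?c A \<in> corner_colourings G \<sigma> \<pi>"
        unfolding corner_colourings_def by (rule CollectI) (use eqs zero in blast)
    qed
    show "?A ` corner_colourings G \<sigma> \<pi> \<subseteq> ?I"
    proof (rule image_subsetI)
      fix c assume c: "c \<in> corner_colourings G \<sigma> \<pi>"
      have "?\<phi> x \<in> ?A c \<and> ?\<rho> x \<in> ?A c" if x: "x \<in> ?A c" for x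
      proof -
        obtain d s where x_eq: "x = (d, s)" by (rule prod.exhaust)
        have d: "d \<in> darts G" and s: "s = 1 \<or> s = -1" using x by (auto simp: x_eq)
        have c1: "(if s = 1 then c d else c (\<pi> d)) = 1" using x by (auto simp: x_eq)
        have "c d + c (\<pi> d) = c (dart_rev d) + c (\<pi> (dart_rev d))"
          "c d + c (dart_rev d) = (if \<sigma> (fst d) = 1 then c d + c (\<pi> d) else 0)"
          using c d unfolding corner_colourings_def by blast+
        then have c2: "\<sigma> (fst d) = 1 \<Longrightarrow> c (\<pi> (dart_rev d)) = c d \<and> c (dart_rev d) = c (\<pi> d)"
          "\<sigma> (fst d) \<noteq> 1 \<Longrightarrow> c (dart_rev d) = c d \<and> c (\<pi> (dart_rev d)) = c (\<pi> d)"
          by (metis add.commute add_left_cancel, metis add_left_cancel bit_add_eq_0_iff)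
        have "snd (?\<phi> x) = 1 \<longrightarrow> c (fst (?\<phi> x)) = 1" "snd (?\<phi> x) \<noteq> 1 \<longrightarrow> c (\<pi> (fst (?\<phi> x))) = 1"
          "snd (?\<rho> x) = 1 \<longrightarrow> c (fst (?\<rho> x)) = 1" "snd (?\<rho> x) \<noteq> 1 \<longrightarrow> c (\<pi> (fst (?\<rho> x))) = 1"
          using s sgn[OF d] c1
          by (elim disjE; simp add: x_eq face_step_def state_rev_def c2 \<pi>_inv)+
        moreover have "x \<in> ?S" using x by blast
        ultimately show ?thesis using \<phi>S \<rho>S by simp
      qed
      then show "?A c \<in> ?I" by blast
    qed
  qed
  then have "card (corner_colourings G \<sigma> \<pi>) = card ?I" by (rule bij_betw_same_card[symmetric])
  also have "\<dots> = 2 ^ card (faces G \<sigma> \<pi>)"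
    unfolding faces_def by (rule card_orbit_pairs[OF fin \<phi>S \<rho>S \<rho>\<rho> \<phi>\<rho>\<phi>])
  finally show ?thesis .
qed

end

section \<open>Rankings and rotation systems\<close>

text \<open>The first alternative makes \<open>\<pi> d\<close> the next dart above \<open>d\<close>;
  the second wraps round from the highest dart to the lowest.\<close>

definition realises ::
    "('v, 'e) pre_digraph \<Rightarrow> ('e dart \<Rightarrow> real) \<Rightarrow> ('e dart \<Rightarrow> 'e dart) \<Rightarrow> bool" where
  "realises G r \<pi> \<longleftrightarrow> (\<forall>d\<in>darts G.
     (\<forall>a\<in>darts_at G (dart_origin G d). r a < r (\<pi> d) \<longleftrightarrow> r a \<le> r d) \<or>
     (\<forall>a\<in>darts_at G (dart_origin G d). r a \<le> r d \<and> r (\<pi> d) \<le> r a))"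

lemma cyclic_on_position:
  assumes "cyclic_on f S"
  shows "\<exists>k :: 'a \<Rightarrow> nat. inj_on k S \<and>
    (\<forall>d\<in>S. k (f d) = Suc (k d) \<or> k (f d) = 0 \<and> (\<forall>a\<in>S. k a \<le> k d))"
proof -
  obtain s where s: "s \<in> S" "S = orbit f s" using assms by (auto simp: cyclic_on_def)
  then have self: "s \<in> orbit f s" by simp
  let ?m = "funpow_dist1 f s s"
  have S: "S = (\<lambda>n. (f ^^ n) s) ` {0..<?m}" using orbit_conv_funpow_dist1[OF self] s by simp
  have elem: "\<exists>n<?m. d = (f ^^ n) s" if "d \<in> S" for d
  proof -
    have "d \<in> (\<lambda>n. (f ^^ n) s) ` {0..<?m}" unfolding S[symmetric] by (rule that)
    then obtain n where "n \<in> {0..<?m}" "d = (f ^^ n) s" by (rule imageE)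
    then show ?thesis by (intro exI[of _ n]) simp
  qed
  have inj: "inj_on (\<lambda>n. (f ^^ n) s) {0..<?m}" by (rule inj_on_funpow_dist1[OF self])
  define k where "k = inv_into {0..<?m} (\<lambda>n. (f ^^ n) s)"
  have k: "k ((f ^^ n) s) = n" if "n < ?m" for n
    unfolding k_def by (rule inv_into_f_f[OF inj, of n]) (use that in simp)
  have "inj_on k S" unfolding k_def S by (rule inj_on_inv_into) simp
  moreover have "k (f d) = Suc (k d) \<or> k (f d) = 0 \<and> (\<forall>a\<in>S. k a \<le> k d)" if d: "d \<in> S" for d
  proof -
    obtain n where n: "n < ?m" "d = (f ^^ n) s" using elem[OF d] by blast
    have fd: "f d = (f ^^ Suc n) s" by (simp add: n(2))
    show ?thesis
    proof (cases "Suc n < ?m")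
      case True
      then show ?thesis using k[OF True] k[OF n(1)] by (simp add: n(2))
    next
      case False
      then have m: "Suc n = ?m" using n(1) by linarith
      have "f d = s" using funpow_dist1_prop[OF self] by (simp only: fd m)
      moreover have "k s = 0" using k[of 0] by simp
      moreover have "k a \<le> k d" if a: "a \<in> S" for a
      proof -
        obtain i where i: "i < ?m" "a = (f ^^ i) s" using elem[OF a] by blast
        then show ?thesis using k[OF i(1)] k[OF n(1)] m n(2) by simp
      qed
      ultimately show ?thesis by simp
    qed
  qed
  ultimately show ?thesis by blast
qed

text \<open>Counting smaller elements identifies the set with \<open>{..<n}\<close>, where the
  successor is addition of 1 modulo \<open>n\<close>.\<close>

lemma exists_cyclic_successor:
  fixes r :: "'a \<Rightarrow> real"
  assumes fin: "finite S" and ne: "S \<noteq> {}" and inj: "inj_on r S"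
  shows "\<exists>f. cyclic_on f S \<and> bij_betw f S S \<and>
    (\<forall>d\<in>S. (\<forall>a\<in>S. r a < r (f d) \<longleftrightarrow> r a \<le> r d) \<or> (\<forall>a\<in>S. r a \<le> r d \<and> r (f d) \<le> r a))"
proof -
  define n where "n = card S"
  have n: "n > 0" using fin ne by (simp add: n_def card_gt_0_iff)
  define k where "k = (\<lambda>d. card {a \<in> S. r a < r d})"
  have mono: "k a < k d" if "a \<in> S" "d \<in> S" "r a < r d" for a d
    unfolding k_def using that fin by (intro psubset_card_mono) auto
  have less_iff: "r a < r d \<longleftrightarrow> k a < k d" if "a \<in> S" "d \<in> S" for a d
    using mono[of a d] mono[of d a] that inj by (metis inj_onD less_asym linorder_neqE)
  then have le_iff: "r a \<le> r d \<longleftrightarrow> k a \<le> k d" if "a \<in> S" "d \<in> S" for a d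
    using that by (simp flip: not_less)
  have "inj_on k S"
    using le_iff inj by (intro inj_onI) (metis inj_onD order_antisym order_refl)
  moreover have "k d < n" if "d \<in> S" for d
    unfolding k_def n_def using that fin by (intro psubset_card_mono) auto
  ultimately have bij: "bij_betw k S {..<n}"
    unfolding bij_betw_def by (metis card_image card_lessThan card_subset_eq finite_lessThan
        image_subsetI lessThan_iff n_def)
  define h where "h = inv_into S k"
  have h: "h i \<in> S" "k (h i) = i" if "i < n" for i
    using bij that by (simp_all add: h_def bij_betw_def inv_into_into f_inv_into_f)
  have hk: "h (k d) = d" and kn: "k d < n" if "d \<in> S" for d
    using bij that by (auto simp: h_def bij_betw_def)
  define f where "f = (\<lambda>d. h (Suc (k d) mod n))"
  have fS: "f d \<in> S" and kf: "k (f d) = Suc (k d) mod n" if "d \<in> S" for d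
    using n by (simp_all add: f_def h)
  have iter: "(f ^^ j) d \<in> S \<and> k ((f ^^ j) d) = (k d + j) mod n" if "d \<in> S" for j d
    using that by (induction j) (simp_all add: fS kf kn mod_Suc_eq)
  have f_surj: "\<exists>j>0. (f ^^ j) (h 0) = d" if "d \<in> S" for d
  proof (intro exI conjI)
    \<comment> \<open>The number of steps must be positive, and \<open>k d\<close> may be 0; hence
      the extra full round.\<close>
    show "(f ^^ (k d + n)) (h 0) = d"
      using iter[OF h(1)[OF n], of "k d + n"] hk[OF that] kn[OF that] h[OF n] hk
      by (metis add_0 mod_add_self2 mod_less)
    show "k d + n > 0" using n by simp
  qed
  have "S = orbit f (h 0)"
    unfolding orbit_altdef using f_surj iter[OF h(1)[OF n]] by blast
  then have cyc: "cyclic_on f S" using h(1)[OF n] by (auto simp: cyclic_on_def)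
  have "f ` S = S"
  proof (intro equalityI subsetI)
    fix d assume "d \<in> S"
    then obtain j where j: "j > 0" "(f ^^ j) (h 0) = d" using f_surj by blast
    then obtain i where "j = Suc i" by (cases j) auto
    then have "d = f ((f ^^ i) (h 0))" using j by simp
    then show "d \<in> f ` S" using iter[OF h(1)[OF n], of i] by blast
  qed (auto simp: fS)
  then have "bij_betw f S S" using fin by (simp add: bij_betw_def finite_surj_inj)
  moreover have "(\<forall>a\<in>S. r a < r (f d) \<longleftrightarrow> r a \<le> r d) \<or> (\<forall>a\<in>S. r a \<le> r d \<and> r (f d) \<le> r a)"
    if d: "d \<in> S" for d
  proof (cases "Suc (k d) < n")
    case True
    then have "k (f d) = Suc (k d)" by (simp add: kf d)
    then show ?thesis by (simp add: less_iff le_iff fS d less_Suc_eq_le)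
  next
    case False
    then have "Suc (k d) = n" using kn[OF d] by linarith
    then have "k (f d) = 0" "\<forall>a\<in>S. k a \<le> k d" using kn by (auto simp: kf d less_Suc_eq_le)
    then show ?thesis by (simp add: le_iff fS d)
  qed
  ultimately show ?thesis using cyc by blast
qed

context fin_digraph
begin

lemma dart_origin_in_verts: "d \<in> darts G \<Longrightarrow> dart_origin G d \<in> verts G"
  by (auto simp: darts_def dart_origin_def)

lemma rotation_system_cyclic:
  assumes "rotation_system G \<pi>" "d \<in> darts G"
  shows "cyclic_on \<pi> (darts_at G (dart_origin G d))"
proof -
  have "d \<in> darts_at G (dart_origin G d)" using assms(2) by (simp add: darts_at_def)
  then show ?thesis
    using assms(1) dart_origin_in_verts[OF assms(2)] unfolding rotation_system_def by blast
qed

lemma rotation_system_in_darts_at: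
  assumes "rotation_system G \<pi>" "d \<in> darts_at G v"
  shows "\<pi> d \<in> darts_at G v"
  using cyclic_on_inI[OF rotation_system_cyclic[OF assms(1)], of d d] assms(2)
  by (auto simp: darts_at_def)

lemma exists_ranking:
  assumes \<pi>: "rotation_system G \<pi>"
  shows "\<exists>r. dart_ranking G r \<and> realises G r \<pi>"
proof -
  let ?P = "\<lambda>v k. inj_on k (darts_at G v) \<and> (\<forall>d\<in>darts_at G v.
    k (\<pi> d) = Suc (k d) \<or> k (\<pi> d) = 0 \<and> (\<forall>a\<in>darts_at G v. k a \<le> k d))"
  have "\<exists>k. ?P v k" for v
  proof (cases "darts_at G v = {}")
    case False
    then obtain d where "d \<in> darts G" "dart_origin G d = v" by (auto simp: darts_at_def)
    then show ?thesis using cyclic_on_position[OF rotation_system_cyclic[OF \<pi>]] by metis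
  qed simp
  then obtain k where k: "\<And>v. ?P v (k v)" by metis
  define r where "r = (\<lambda>d. real (k (dart_origin G d) d))"
  have r: "r d = real (k v d)" if "d \<in> darts_at G v" for d v
    using that by (simp add: r_def darts_at_def)
  have "dart_ranking G r"
    unfolding dart_ranking_def
  proof (intro ballI impI)
    fix a d assume "a \<in> darts G" "d \<in> darts G" "dart_origin G a = dart_origin G d" "r a = r d"
    then show "a = d"
      using k[of "dart_origin G d"] by (auto simp: r_def darts_at_def dest: inj_onD)
  qed
  moreover have "realises G r \<pi>"
    unfolding realises_def
  proof
    fix d assume "d \<in> darts G"
    let ?v = "dart_origin G d"
    have d: "d \<in> darts_at G ?v" using \<open>d \<in> darts G\<close> by (simp add: darts_at_def)
    note \<pi>d = rotation_system_in_darts_at[OF \<pi> d]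
    have "k ?v (\<pi> d) = Suc (k ?v d) \<or> k ?v (\<pi> d) = 0 \<and> (\<forall>a\<in>darts_at G ?v. k ?v a \<le> k ?v d)"
      using k[of ?v] d by blast
    then show "(\<forall>a\<in>darts_at G ?v. r a < r (\<pi> d) \<longleftrightarrow> r a \<le> r d) \<or>
        (\<forall>a\<in>darts_at G ?v. r a \<le> r d \<and> r (\<pi> d) \<le> r a)"
      by (elim disjE) (simp_all add: r[OF d] r[OF \<pi>d] r less_Suc_eq_le del: of_nat_Suc)
  qed
  ultimately show ?thesis by blast
qed

lemma exists_rotation_system:
  assumes r: "dart_ranking G r"
  shows "\<exists>\<pi>. rotation_system G \<pi> \<and> realises G r \<pi>"
proof -
  let ?P = "\<lambda>v f. cyclic_on f (darts_at G v) \<and> bij_betw f (darts_at G v) (darts_at G v) \<and>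
    (\<forall>d\<in>darts_at G v. (\<forall>a\<in>darts_at G v. r a < r (f d) \<longleftrightarrow> r a \<le> r d) \<or>
      (\<forall>a\<in>darts_at G v. r a \<le> r d \<and> r (f d) \<le> r a))"
  have "\<exists>f. darts_at G v \<noteq> {} \<longrightarrow> ?P v f" for v
  proof (cases "darts_at G v = {}")
    case False
    have "inj_on r (darts_at G v)"
      using r by (auto simp: inj_on_def dart_ranking_def darts_at_def)
    from exists_cyclic_successor[OF finite_darts_at False this] show ?thesis by blast
  qed simp
  then obtain f where f: "\<And>v. darts_at G v \<noteq> {} \<Longrightarrow> ?P v (f v)" by metis
  define \<pi> where "\<pi> = (\<lambda>d. if d \<in> darts G then f (dart_origin G d) d else d)"
  have \<pi>: "\<pi> d = f v d" if "d \<in> darts_at G v" for d v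
    using that by (simp add: \<pi>_def darts_at_def)
  have \<pi>_bij: "bij_betw \<pi> (darts_at G v) (darts_at G v)" for v
  proof (cases "darts_at G v = {}")
    case False
    then show ?thesis using f[OF False] by (simp add: \<pi> cong: bij_betw_cong)
  qed (simp add: bij_betw_def)
  have "\<pi> ` darts G = darts G"
  proof (intro equalityI subsetI)
    fix d assume "d \<in> \<pi> ` darts G"
    then obtain a where "a \<in> darts_at G (dart_origin G a)" "d = \<pi> a" by (auto simp: darts_at_def)
    then have "d \<in> darts_at G (dart_origin G a)" using \<pi>_bij by (auto simp: bij_betw_def)
    then show "d \<in> darts G" by (simp add: darts_at_def)
  next
    fix d assume "d \<in> darts G"
    then have "d \<in> darts_at G (dart_origin G d)" by (simp add: darts_at_def)
    then have "d \<in> \<pi> ` darts_at G (dart_origin G d)" using \<pi>_bij by (simp add: bij_betw_def)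
    then show "d \<in> \<pi> ` darts G" by (auto simp: darts_at_def)
  qed
  then have "bij_betw \<pi> (darts G) (darts G)" by (simp add: bij_betw_def finite_surj_inj)
  then have "\<pi> permutes darts G" by (rule bij_imp_permutes) (simp add: \<pi>_def)
  moreover have "cyclic_on \<pi> (darts_at G v)" if "darts_at G v \<noteq> {}" for v
    using f[OF that] cyclic_cong[of "darts_at G v" \<pi> "f v"] by (simp add: \<pi>)
  moreover have "realises G r \<pi>"
    unfolding realises_def
  proof
    fix d assume "d \<in> darts G"
    let ?v = "dart_origin G d"
    have d: "d \<in> darts_at G ?v" using \<open>d \<in> darts G\<close> by (simp add: darts_at_def)
    then have "darts_at G ?v \<noteq> {}" by blast
    from f[OF this] d show "(\<forall>a\<in>darts_at G ?v. r a < r (\<pi> d) \<longleftrightarrow> r a \<le> r d) \<or>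
        (\<forall>a\<in>darts_at G ?v. r a \<le> r d \<and> r (\<pi> d) \<le> r a)"
      unfolding \<pi>[OF d] by blast
  qed
  ultimately show ?thesis unfolding rotation_system_def by blast
qed

end

section \<open>Corner colourings and the radical\<close>

text \<open>The colouring with jump \<open>x\<close> across each dart, normalised to 0 at the corner
  before the lowest dart of each vertex.\<close>

definition corner_height ::
    "('v, 'e) pre_digraph \<Rightarrow> ('e dart \<Rightarrow> real) \<Rightarrow> ('e \<Rightarrow> bit) \<Rightarrow> 'e dart \<Rightarrow> bit" where
  "corner_height G r x d =
     (if d \<in> darts G then \<Sum>a | a \<in> darts_at G (dart_origin G d) \<and> r a < r d. x (fst a) else 0)"

definition side_defect :: "('e \<Rightarrow> int) \<Rightarrow> ('e dart \<Rightarrow> bit) \<Rightarrow> ('e \<Rightarrow> bit) \<Rightarrow> 'e \<Rightarrow> bit" where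
  "side_defect \<sigma> c x e = c (e, True) + c (e, False) + (if \<sigma> e = 1 then x e else 0)"

text \<open>The boundary modulo 2 of a set of faces: the edges whose two sides have different
  colours. In a corner colouring the other dart of the edge gives the same value.\<close>

definition corner_jump ::
    "('v, 'e) pre_digraph \<Rightarrow> ('e dart \<Rightarrow> 'e dart) \<Rightarrow> ('e dart \<Rightarrow> bit) \<Rightarrow> 'e \<Rightarrow> bit" where
  "corner_jump G \<pi> c e = (if e \<in> arcs G then c (e, True) + c (\<pi> (e, True)) else 0)"

text \<open>These are constant on the components of the graph, so that their number does not depend on the
  rotation system.\<close>

definition jumpless_colourings :: "('v, 'e) pre_digraph \<Rightarrow> ('e dart \<Rightarrow> bit) set" where
  "jumpless_colourings G = {c. (\<forall>d. d \<notin> darts G \<longrightarrow> c d = 0) \<and>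
     (\<forall>a\<in>darts G. \<forall>d\<in>darts G. dart_origin G a = dart_origin G d \<longrightarrow> c a = c d) \<and>
     (\<forall>d\<in>darts G. c (dart_rev d) = c d)}"

lemma corner_colouring_jump:
  assumes "c \<in> corner_colourings G \<sigma> \<pi>" "d \<in> darts G"
  shows "corner_jump G \<pi> c (fst d) = c d + c (\<pi> d)"
proof (cases "snd d")
  case True
  then have "d = (fst d, True)" by (simp add: prod_eq_iff)
  then show ?thesis using assms(2) by (metis corner_jump_def darts_def mem_Times_iff)
next
  case False
  then have d: "dart_rev d = (fst d, True)" by (simp add: dart_rev_def)
  have "c d + c (\<pi> d) = c (dart_rev d) + c (\<pi> (dart_rev d))"
    using assms unfolding corner_colourings_def by blast
  moreover have "fst d \<in> arcs G" using assms(2) by (auto simp: darts_def)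
  ultimately show ?thesis by (simp add: corner_jump_def d)
qed

lemma corner_colouring_defect:
  assumes "c \<in> corner_colourings G \<sigma> \<pi>" "e \<in> arcs G"
  shows "side_defect \<sigma> c (corner_jump G \<pi> c) e = 0"
proof -
  have d: "(e, True) \<in> darts G" using assms(2) by (simp add: darts_def)
  have "c (e, True) + c (dart_rev (e, True)) =
      (if \<sigma> (fst (e, True)) = 1 then c (e, True) + c (\<pi> (e, True)) else 0)"
    using assms(1) d unfolding corner_colourings_def by blast
  then show ?thesis
    using assms(2) by (simp add: side_defect_def corner_jump_def dart_rev_def)
qed

lemma corner_colouringI:
  assumes "\<And>d. d \<notin> darts G \<Longrightarrow> c d = 0" "\<And>e. e \<notin> arcs G \<Longrightarrow> x e = 0"
    and jump: "\<And>d. d \<in> darts G \<Longrightarrow> c d + c (\<pi> d) = x (fst d)"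
    and defect: "\<And>e. e \<in> arcs G \<Longrightarrow> side_defect \<sigma> c x e = 0"
  shows "c \<in> corner_colourings G \<sigma> \<pi>" "corner_jump G \<pi> c = x"
proof -
  have "c d + c (\<pi> d) = c (dart_rev d) + c (\<pi> (dart_rev d)) \<and>
      c d + c (dart_rev d) = (if \<sigma> (fst d) = 1 then c d + c (\<pi> d) else 0)" if d: "d \<in> darts G" for d
  proof -
    have "side_defect \<sigma> c x (fst d) = 0" using d defect by (auto simp: darts_def)
    moreover have "c (fst d, True) + c (fst d, False) = c d + c (dart_rev d)"
      by (cases d; cases "snd d") (simp_all add: dart_rev_def add.commute)
    ultimately have "c d + c (dart_rev d) = (if \<sigma> (fst d) = 1 then x (fst d) else 0)"
      by (auto simp: side_defect_def bit_add_eq_0_iff)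
    then show ?thesis using jump[OF d] jump[of "dart_rev d"] d by simp
  qed
  then show "c \<in> corner_colourings G \<sigma> \<pi>"
    unfolding corner_colourings_def using assms(1) by blast
  show "corner_jump G \<pi> c = x"
  proof
    fix e
    show "corner_jump G \<pi> c e = x e"
      using jump[of "(e, True)"] assms(2)[of e] by (simp add: corner_jump_def darts_def)
  qed
qed

lemma two_group_corner_colourings: "two_group (corner_colourings G \<sigma> \<pi>)"
proof
  fix x y assume x: "x \<in> corner_colourings G \<sigma> \<pi>" and y: "y \<in> corner_colourings G \<sigma> \<pi>"
  have plus: "(x + y) a + (x + y) b = (x a + x b) + (y a + y b)" for a b by (simp add: add_ac)
  have "(x + y) d + (x + y) (\<pi> d) = (x + y) (dart_rev d) + (x + y) (\<pi> (dart_rev d)) \<and>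
      (x + y) d + (x + y) (dart_rev d) = (if \<sigma> (fst d) = 1 then (x + y) d + (x + y) (\<pi> d) else 0)"
    if d: "d \<in> darts G" for d
  proof -
    have "c d + c (\<pi> d) = c (dart_rev d) + c (\<pi> (dart_rev d))"
      "c d + c (dart_rev d) = (if \<sigma> (fst d) = 1 then c d + c (\<pi> d) else 0)"
      if "c \<in> corner_colourings G \<sigma> \<pi>" for c
      using that d unfolding corner_colourings_def by blast+
    from this[OF x] this[OF y] show ?thesis unfolding plus by simp
  qed
  moreover have "(x + y) d = 0" if "d \<notin> darts G" for d
  proof -
    have "x d = 0" "y d = 0" using that x y unfolding corner_colourings_def by blast+
    then show ?thesis by simp
  qed
  ultimately show "x + y \<in> corner_colourings G \<sigma> \<pi>"
    unfolding corner_colourings_def by blast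
qed (auto simp: corner_colourings_def fun_eq_iff)

context fin_digraph
begin

lemma sum_darts_at: "(\<Sum>v\<in>verts G. \<Sum>d\<in>darts_at G v. g d) = (\<Sum>d\<in>darts G. g d)"
  unfolding darts_at_def
  by (rule sum.group) (auto intro: dart_origin_in_verts)

lemma corner_height_step:
  assumes \<pi>: "rotation_system G \<pi>" and r: "dart_ranking G r" "realises G r \<pi>"
    and x: "x \<in> cycle_space G" and d: "d \<in> darts G"
  shows "corner_height G r x d + corner_height G r x (\<pi> d) = x (fst d)"
proof -
  let ?D = "darts_at G (dart_origin G d)"
  let ?L = "{a. a \<in> ?D \<and> r a < r d}"
  have dD: "d \<in> ?D" using d by (simp add: darts_at_def)
  have \<pi>D: "\<pi> d \<in> ?D" by (rule rotation_system_in_darts_at[OF \<pi> dD])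
  then have height: "corner_height G r x (\<pi> d) = (\<Sum>a | a \<in> ?D \<and> r a < r (\<pi> d). x (fst a))"
    by (simp add: corner_height_def darts_at_def)
  have eq: "a = d" if "a \<in> ?D" "r a = r d" for a
    using r(1) that d unfolding dart_ranking_def darts_at_def by blast
  have insert: "(\<Sum>a\<in>insert d ?L. x (fst a)) = corner_height G r x d + x (fst d)"
    using d by (simp add: corner_height_def add.commute)
  consider "\<forall>a\<in>?D. r a < r (\<pi> d) \<longleftrightarrow> r a \<le> r d" | "\<forall>a\<in>?D. r a \<le> r d \<and> r (\<pi> d) \<le> r a"
    using r(2) d unfolding realises_def by blast
  then show ?thesis
  proof cases
    case 1
    then have "{a. a \<in> ?D \<and> r a < r (\<pi> d)} = insert d ?L"
      using dD eq by (auto simp: order_le_less)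
    then show ?thesis using insert by (simp add: height)
  next
    case 2
    then have none: "{a. a \<in> ?D \<and> r a < r (\<pi> d)} = {}" by auto
    \<comment> \<open>Past the highest dart the height returns to 0; the jump is still right because
      \<open>x\<close> has even degree at the vertex.\<close>
    have "?D = insert d ?L" using 2 dD eq by (auto simp: order_le_less)
    then have "(\<Sum>a\<in>insert d ?L. x (fst a)) = 0" using x by (simp add: cycle_space_def)
    then show ?thesis using insert by (simp add: height none bit_add_eq_0_iff)
  qed
qed

text \<open>Collecting terms by the darts of \<open>y\<close>, the heights at both ends of
  \<open>e\<close> and the sign term make up the coefficient of \<open>y e\<close>. So a cycle is in
  the radical iff its side defect annihilates all cycles.\<close>

lemma crossing_form_eq_side_defect:
  "crossing_form G \<sigma> r x y = (\<Sum>e\<in>arcs G. side_defect \<sigma> (corner_height G r x) x e * y e)"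
proof -
  have "before G r = prod.swap ` (SIGMA d:darts G. {a. a \<in> darts_at G (dart_origin G d) \<and> r a < r d})"
    by (auto simp: before_def darts_at_def image_iff)
  then have "(\<Sum>(a, d)\<in>before G r. x (fst a) * y (fst d)) =
      (\<Sum>(d, a)\<in>(SIGMA d:darts G. {a. a \<in> darts_at G (dart_origin G d) \<and> r a < r d}). x (fst a) * y (fst d))"
    by (simp add: sum.reindex comp_def case_prod_unfold)
  also have "\<dots> = (\<Sum>d\<in>darts G. corner_height G r x d * y (fst d))"
    by (subst sum.Sigma[symmetric]) (auto simp: corner_height_def sum_distrib_right intro!: sum.cong)
  also have "\<dots> = (\<Sum>e\<in>arcs G. corner_height G r x (e, True) * y e + corner_height G r x (e, False) * y e)"
    by (simp add: sum_darts)
  finally have crossings: "(\<Sum>(a, d)\<in>before G r. x (fst a) * y (fst d)) = \<dots>" .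
  have "(\<Sum>e | e \<in> arcs G \<and> \<sigma> e = 1. x e * y e) = (\<Sum>e\<in>arcs G. (if \<sigma> e = 1 then x e else 0) * y e)"
    by (simp add: sum.inter_filter if_distrib[of "\<lambda>z. z * _"] cong: if_cong)
  then show ?thesis
    unfolding crossing_form_def crossings side_defect_def
    by (simp add: sum.distrib distrib_right)
qed

lemma sum_origin_const:
  assumes "y \<in> cycle_space G"
  shows "(\<Sum>d\<in>darts G. k (dart_origin G d) * y (fst d)) = 0"
proof -
  have "(\<Sum>d\<in>darts_at G v. k (dart_origin G d) * y (fst d)) = 0" for v
  proof -
    have "(\<Sum>d\<in>darts_at G v. k (dart_origin G d) * y (fst d)) = k v * (\<Sum>d\<in>darts_at G v. y (fst d))"
      unfolding sum_distrib_left by (rule sum.cong) (auto simp: darts_at_def)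
    then show ?thesis using assms by (simp add: cycle_space_def)
  qed
  then show ?thesis unfolding sum_darts_at[symmetric] by simp
qed

lemma rotation_invariant:
  assumes \<pi>: "rotation_system G \<pi>" and g: "\<And>d. d \<in> darts G \<Longrightarrow> g (\<pi> d) = g d"
    and ad: "a \<in> darts G" "d \<in> darts G" "dart_origin G a = dart_origin G d"
  shows "g a = g d"
proof -
  have "darts_at G (dart_origin G d) = orbit \<pi> d"
    using rotation_system_cyclic[OF \<pi> ad(2)] by (rule orbit_cyclic_eq3[symmetric])
      (simp add: darts_at_def ad(2))
  then have "a \<in> orbit \<pi> d" using ad by (auto simp: darts_at_def)
  moreover have "b \<in> darts G \<Longrightarrow> \<pi> b \<in> darts G" for b
    using \<pi> by (simp add: rotation_system_def permutes_in_image)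
  ultimately have "a \<in> darts G \<and> g a = g d"
    by (induction rule: orbit.induct) (simp_all add: ad(2) g)
  then show ?thesis ..
qed

lemma rotation_bij_darts_at:
  assumes "rotation_system G \<pi>"
  shows "bij_betw \<pi> (darts_at G v) (darts_at G v)"
proof -
  have "inj_on \<pi> (darts_at G v)"
    using assms by (auto simp: rotation_system_def intro: permutes_inj_on)
  then show ?thesis
    using rotation_system_in_darts_at[OF assms] by (simp add: bij_betw_def endo_inj_surj image_subsetI)
qed

text \<open>A colouring and the height of its jump have equal jumps, so they differ by a constant
  \<open>k v\<close> at each vertex. As \<open>c\<close> has no side defect, that of the height is
  the coboundary of \<open>k\<close>, which annihilates cycles.\<close>

lemma corner_jump_in_radical:
  assumes \<pi>: "rotation_system G \<pi>" and r: "dart_ranking G r" "realises G r \<pi>"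
    and c: "c \<in> corner_colourings G \<sigma> \<pi>"
  shows "corner_jump G \<pi> c \<in> radical (cycle_space G) (crossing_form G \<sigma> r)"
proof -
  let ?x = "corner_jump G \<pi> c" and ?h = "corner_height G r (corner_jump G \<pi> c)"
  have "(\<Sum>d\<in>darts_at G v. ?x (fst d)) = 0" for v
  proof -
    have "(\<Sum>d\<in>darts_at G v. ?x (fst d)) = (\<Sum>d\<in>darts_at G v. c d) + (\<Sum>d\<in>darts_at G v. c (\<pi> d))"
      unfolding sum.distrib[symmetric]
      by (rule sum.cong) (auto simp: corner_colouring_jump[OF c] darts_at_def)
    then show ?thesis by (simp add: sum.reindex_bij_betw[OF rotation_bij_darts_at[OF \<pi>]])
  qed
  then have x: "?x \<in> cycle_space G" by (simp add: cycle_space_def corner_jump_def)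
  let ?g = "\<lambda>d. c d + ?h d"
  have "?g (\<pi> d) = ?g d" if "d \<in> darts G" for d
    using corner_colouring_jump[OF c that] corner_height_step[OF \<pi> r x that]
    by (metis add.assoc add.commute bit_add_self_left)
  note const = rotation_invariant[OF \<pi>, where g = ?g, OF this]
  define k where "k v = ?g (SOME d. d \<in> darts_at G v)" for v
  have k: "?g d = k (dart_origin G d)" if "d \<in> darts G" for d
  proof -
    have "(SOME a. a \<in> darts_at G (dart_origin G d)) \<in> darts_at G (dart_origin G d)"
      by (rule someI[of _ d]) (simp add: that darts_at_def)
    then show ?thesis unfolding k_def by (intro const that) (auto simp: darts_at_def)
  qed
  have "crossing_form G \<sigma> r ?x y = 0" if y: "y \<in> cycle_space G" for y
  proof -
    have "side_defect \<sigma> ?h ?x e = ?g (e, True) + ?g (e, False)" if e: "e \<in> arcs G" for e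
    proof -
      have "?g (e, True) + ?g (e, False) = side_defect \<sigma> c ?x e + side_defect \<sigma> ?h ?x e"
        by (simp add: side_defect_def add_ac)
      then show ?thesis by (simp add: corner_colouring_defect[OF c e])
    qed
    then have "crossing_form G \<sigma> r ?x y = (\<Sum>d\<in>darts G. ?g d * y (fst d))"
      by (simp add: crossing_form_eq_side_defect sum_darts distrib_right)
    also have "\<dots> = (\<Sum>d\<in>darts G. k (dart_origin G d) * y (fst d))"
      by (rule sum.cong) (simp_all add: k)
    finally show ?thesis using sum_origin_const[OF y] by simp
  qed
  then show ?thesis using x by (simp add: radical_def)
qed

text \<open>A side defect that annihilates all cycles is a coboundary, and shifting the height by
  the vertex potential removes it.\<close>

lemma radical_corner_jump:
  assumes \<pi>: "rotation_system G \<pi>" and r: "dart_ranking G r" "realises G r \<pi>"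
    and x: "x \<in> radical (cycle_space G) (crossing_form G \<sigma> r)"
  shows "\<exists>c\<in>corner_colourings G \<sigma> \<pi>. corner_jump G \<pi> c = x"
proof -
  let ?h = "corner_height G r x"
  let ?Y = "{y :: 'b \<Rightarrow> bit. \<forall>e. e \<notin> arcs G \<longrightarrow> y e = 0}"
  let ?\<psi> = "\<lambda>y. \<Sum>e\<in>arcs G. side_defect \<sigma> ?h x e * y e"
  let ?\<phi> = "\<lambda>v y. \<Sum>d\<in>darts_at G v. y (fst d) :: bit"
  have xZ: "x \<in> cycle_space G" using x by (simp add: radical_def)
  \<comment> \<open>The cycles are the common kernel of the degree functionals
    \<open>?\<phi> v\<close> on all edge sets, so duality supplies the vertices to be
    shifted.\<close>
  have "\<exists>J\<subseteq>verts G. \<forall>y\<in>?Y. ?\<psi> y = (\<Sum>v\<in>J. ?\<phi> v y)"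
  proof (rule functional_eq_sum)
    show "two_group ?Y" by unfold_locales (auto simp: fun_eq_iff)
    fix y assume y: "y \<in> ?Y" "\<forall>v\<in>verts G. ?\<phi> v y = 0"
    have "?\<phi> v y = 0" for v
    proof (cases "v \<in> verts G")
      case False
      then have "darts_at G v = {}" using dart_origin_in_verts by (auto simp: darts_at_def)
      then show ?thesis by simp
    qed (use y in blast)
    then have "y \<in> cycle_space G" using y(1) by (simp add: cycle_space_def)
    then show "?\<psi> y = 0"
      using x by (simp add: radical_def flip: crossing_form_eq_side_defect)
  qed (simp_all add: additive_on_def sum.distrib distrib_left)
  then obtain J where J: "J \<subseteq> verts G" "\<And>y. y \<in> ?Y \<Longrightarrow> ?\<psi> y = (\<Sum>v\<in>J. ?\<phi> v y)" by blast
  define k where "k d = (of_bool (dart_origin G d \<in> J) :: bit)" for d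
  have defect: "side_defect \<sigma> ?h x e = k (e, True) + k (e, False)" if e: "e \<in> arcs G" for e
  proof -
    \<comment> \<open>A single edge as test vector reads off one coefficient.\<close>
    let ?y = "\<lambda>e'. of_bool (e' = e) :: bit"
    have "side_defect \<sigma> ?h x e = ?\<psi> ?y"
      using e by (simp add: of_bool_def if_distrib[of "\<lambda>z. _ * z"] cong: if_cong)
    also have "\<dots> = (\<Sum>v\<in>J. ?\<phi> v ?y)" by (rule J(2)) (use e in auto)
    also have "\<dots> = (\<Sum>v\<in>verts G. of_bool (v \<in> J) * ?\<phi> v ?y)"
      using J(1) by (intro sum.mono_neutral_cong_left) auto
    also have "\<dots> = (\<Sum>v\<in>verts G. \<Sum>d\<in>darts_at G v. k d * ?y (fst d))"
      unfolding sum_distrib_left by (intro sum.cong refl) (auto simp: k_def darts_at_def)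
    also have "\<dots> = (\<Sum>e'\<in>arcs G. (k (e', True) + k (e', False)) * ?y e')"
      unfolding sum_darts_at sum_darts by (simp add: distrib_right)
    also have "\<dots> = k (e, True) + k (e, False)"
      using e by (simp add: of_bool_def if_distrib[of "\<lambda>z. _ * z"] cong: if_cong)
    finally show ?thesis .
  qed
  define c where "c d = (if d \<in> darts G then ?h d + k d else 0)" for d
  have "c d + c (\<pi> d) = x (fst d)" if d: "d \<in> darts G" for d
  proof -
    have "d \<in> darts_at G (dart_origin G d)" using d by (simp add: darts_at_def)
    then have "\<pi> d \<in> darts_at G (dart_origin G d)" by (rule rotation_system_in_darts_at[OF \<pi>])
    then have "\<pi> d \<in> darts G" "k (\<pi> d) = k d" by (simp_all add: darts_at_def k_def)
    moreover have "(?h d + k d) + (?h (\<pi> d) + k d) = ?h d + ?h (\<pi> d)" by (simp add: add_ac)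
    ultimately show ?thesis using corner_height_step[OF \<pi> r xZ d] d by (simp add: c_def)
  qed
  moreover have "side_defect \<sigma> c x e = 0" if e: "e \<in> arcs G" for e
  proof -
    have "side_defect \<sigma> c x e = side_defect \<sigma> ?h x e + (k (e, True) + k (e, False))"
      using e by (simp add: side_defect_def c_def darts_def add_ac)
    then show ?thesis by (simp add: defect[OF e])
  qed
  moreover have "x e = 0" if "e \<notin> arcs G" for e using xZ that by (simp add: cycle_space_def)
  ultimately show ?thesis
    using corner_colouringI[of G c x \<pi> \<sigma>] by (auto simp: c_def)
qed

lemma jump_zero_iff:
  assumes \<pi>: "rotation_system G \<pi>"
  shows "{c \<in> corner_colourings G \<sigma> \<pi>. corner_jump G \<pi> c = 0} = jumpless_colourings G"
proof (intro equalityI subsetI)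
  fix c assume "c \<in> {c \<in> corner_colourings G \<sigma> \<pi>. corner_jump G \<pi> c = 0}"
  then have c: "c \<in> corner_colourings G \<sigma> \<pi>" and jump: "corner_jump G \<pi> c = 0" by simp_all
  have inv: "c (\<pi> d) = c d" if "d \<in> darts G" for d
    using corner_colouring_jump[OF c that] jump by (simp add: bit_add_eq_0_iff)
  have "c d + c (dart_rev d) = (if \<sigma> (fst d) = 1 then c d + c (\<pi> d) else 0)" if "d \<in> darts G" for d
    using c that unfolding corner_colourings_def by blast
  then have "c (dart_rev d) = c d" if "d \<in> darts G" for d
    using inv[OF that] that by (metis bit_add_eq_0_iff)
  moreover have "c d = 0" if "d \<notin> darts G" for d
    using c that unfolding corner_colourings_def by blast
  ultimately show "c \<in> jumpless_colourings G"
    using rotation_invariant[where g = c, OF \<pi> inv] unfolding jumpless_colourings_def by blast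
next
  fix c assume c: "c \<in> jumpless_colourings G"
  have "c (\<pi> d) = c d" if d: "d \<in> darts G" for d
  proof -
    have "d \<in> darts_at G (dart_origin G d)" using d by (simp add: darts_at_def)
    then have "\<pi> d \<in> darts_at G (dart_origin G d)" by (rule rotation_system_in_darts_at[OF \<pi>])
    then show ?thesis using c d unfolding jumpless_colourings_def darts_at_def by blast
  qed
  moreover have "c (e, False) = c (e, True)" if "e \<in> arcs G" for e
  proof -
    have "(e, True) \<in> darts G" using that by (simp add: darts_def)
    then have "c (dart_rev (e, True)) = c (e, True)" using c unfolding jumpless_colourings_def by blast
    then show ?thesis by (simp add: dart_rev_def)
  qed
  moreover have "c d = 0" if "d \<notin> darts G" for d
    using c that unfolding jumpless_colourings_def by blast
  ultimately show "c \<in> {c \<in> corner_colourings G \<sigma> \<pi>. corner_jump G \<pi> c = 0}"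
    using corner_colouringI[of G c 0 \<pi> \<sigma>] by (simp add: side_defect_def)
qed

text \<open>\<open>corner_jump\<close> maps the colourings onto the radical with fibres that are
  translates of its kernel. For a connected graph with edges the kernel has two elements, which
  explains the dimension \<open>f - 1\<close>.\<close>

lemma card_corner_colourings_radical:
  assumes \<pi>: "rotation_system G \<pi>" and r: "dart_ranking G r" "realises G r \<pi>"
  shows "card (corner_colourings G \<sigma> \<pi>) =
    card (jumpless_colourings G) * card (radical (cycle_space G) (crossing_form G \<sigma> r))"
proof -
  let ?C = "corner_colourings G \<sigma> \<pi>" and ?R = "radical (cycle_space G) (crossing_form G \<sigma> r)"
  interpret two_group ?C by (rule two_group_corner_colourings)
  have "finite ?C"
    by (rule finite_subset[OF _ finite_bit_functions[OF finite_darts]])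
      (auto simp: corner_colourings_def)
  moreover have "finite ?R"
    by (rule finite_subset[OF _ finite_cycle_space]) (auto simp: radical_def)
  ultimately have "card ?C = (\<Sum>x\<in>?R. card {c \<in> ?C. corner_jump G \<pi> c = x})"
    using corner_jump_in_radical[OF \<pi> r] sum.group[of ?C ?R "corner_jump G \<pi>" "\<lambda>_. 1 :: nat"]
    by (simp add: image_subsetI)
  also have "\<dots> = (\<Sum>x\<in>?R. card (jumpless_colourings G))"
  proof (rule sum.cong[OF refl])
    fix x assume "x \<in> ?R"
    then obtain c where "c \<in> ?C" "corner_jump G \<pi> c = x" using radical_corner_jump[OF \<pi> r] by blast
    moreover have "additive_on ?C (corner_jump G \<pi>)"
      by (simp add: additive_on_def corner_jump_def fun_eq_iff add_ac)
    ultimately show "card {c \<in> ?C. corner_jump G \<pi> c = x} = card (jumpless_colourings G)"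
      unfolding jump_zero_iff[OF \<pi>, of \<sigma>, symmetric] by (intro card_fibre)
  qed
  finally show ?thesis by simp
qed

end

section \<open>From face counts to the Euler-genus spectrum\<close>

lemma (in signed_graph) card_faces:
  assumes \<pi>: "rotation_system G \<pi>" and r: "dart_ranking G r" "realises G r \<pi>"
  shows "card (jumpless_colourings G) * card (radical (cycle_space G) (crossing_form G \<sigma> r)) =
    2 ^ card (faces G \<sigma> \<pi>)"
  using card_corner_colourings_radical[OF assms, of \<sigma>] card_corner_colourings[of \<pi>] \<pi>
  by (simp add: rotation_system_def)

lemma (in signed_graph) spectrum_below_max:
  assumes M: "M \<in> euler_genus_spectrum G \<sigma>" "\<And>x. x \<in> euler_genus_spectrum G \<sigma> \<Longrightarrow> x \<le> M"
    and N: "N \<in> euler_genus_spectrum G \<sigma>" "odd (M - N)"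
  shows "M - 1 \<in> euler_genus_spectrum G \<sigma>"
proof -
  have arcs: "arcs G \<noteq> {}"
  proof
    assume "arcs G = {}"
    then have "euler_genus G \<sigma> \<pi> = euler_genus G \<sigma> \<pi>'" for \<pi> \<pi>'
      by (simp add: euler_genus_def num_faces_def)
    then have "M = N" using M(1) N(1) unfolding euler_genus_spectrum_def by blast
    with N(2) show False by simp
  qed
  define \<chi> where "\<chi> = int (card (arcs G)) - int (card (verts G)) + 2"
  define rot where "rot r = (SOME \<pi>. rotation_system G \<pi> \<and> realises G r \<pi>)" for r
  define f where "f r = card (faces G \<sigma> (rot r))" for r
  have rot: "rotation_system G (rot r)" "realises G r (rot r)" if "dart_ranking G r" for r
    unfolding rot_def using someI_ex[OF exists_rotation_system[OF that]] by blast+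
  have genus: "euler_genus G \<sigma> \<pi> = \<chi> - int (card (faces G \<sigma> \<pi>))" for \<pi>
    using arcs by (simp add: euler_genus_def num_faces_def \<chi>_def)
  have f: "card (jumpless_colourings G) * card (radical (cycle_space G) (crossing_form G \<sigma> r)) = 2 ^ f r"
    if "dart_ranking G r" for r
    unfolding f_def by (rule card_faces[OF rot(1)[OF that] that rot(2)[OF that]])
  have spectrum: "x \<in> euler_genus_spectrum G \<sigma> \<longleftrightarrow> (\<exists>r. dart_ranking G r \<and> x = \<chi> - int (f r))" for x
  proof
    assume "x \<in> euler_genus_spectrum G \<sigma>"
    then obtain \<pi> where \<pi>: "rotation_system G \<pi>" "x = \<chi> - int (card (faces G \<sigma> \<pi>))"
      by (auto simp: euler_genus_spectrum_def genus)
    obtain r where r: "dart_ranking G r" "realises G r \<pi>" using exists_ranking[OF \<pi>(1)] by blast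
    \<comment> \<open>The radical determines the number of faces, so all rotation systems realising
      \<open>r\<close> share it and the choice in \<open>rot\<close> is harmless.\<close>
    have "(2::nat) ^ card (faces G \<sigma> \<pi>) = 2 ^ f r"
      using card_faces[OF \<pi>(1) r] f[OF r(1)] by simp
    then show "\<exists>r. dart_ranking G r \<and> x = \<chi> - int (f r)" using \<pi>(2) r(1) by auto
  next
    assume "\<exists>r. dart_ranking G r \<and> x = \<chi> - int (f r)"
    then show "x \<in> euler_genus_spectrum G \<sigma>"
      using rot(1) by (auto simp: euler_genus_spectrum_def genus f_def)
  qed
  obtain p where p: "dart_ranking G p" "M = \<chi> - int (f p)" using M(1) spectrum by blast
  obtain p' where p': "dart_ranking G p'" "N = \<chi> - int (f p')" using N(1) spectrum by blast
  have "f p \<le> f q" if "dart_ranking G q" for q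
  proof -
    have "\<chi> - int (f q) \<in> euler_genus_spectrum G \<sigma>" using that spectrum by blast
    then show ?thesis using M(2) p(2) by fastforce
  qed
  moreover have "odd (f p + f p')" using N(2) p(2) p'(2) by simp
  ultimately obtain q where "dart_ranking G q" "f q = f p + 1"
    using exists_next_ranking[OF f p(1) _ p'(1)] by blast
  then show ?thesis using spectrum p(2) by auto
qed

text \<open>The larger maximum bounds the whole spectrum, so its predecessor occurs, and it has the
  other parity.\<close>

lemma (in signed_graph) Max_parity_spectrum_adjacent:
  assumes S: "parity_spectrum G \<sigma> i \<noteq> {}" "parity_spectrum G \<sigma> j \<noteq> {}" and ij: "odd (i - j)"
    and le: "Max (parity_spectrum G \<sigma> j) \<le> Max (parity_spectrum G \<sigma> i)"
  shows "Max (parity_spectrum G \<sigma> i) - Max (parity_spectrum G \<sigma> j) = 1"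
proof -
  let ?M = "Max (parity_spectrum G \<sigma> i)" and ?N = "Max (parity_spectrum G \<sigma> j)"
  have fin: "finite (parity_spectrum G \<sigma> k)" for k
    by (rule finite_parity_spectrum) (rule signed_graph_axioms)
  have "?M \<in> parity_spectrum G \<sigma> i" "?N \<in> parity_spectrum G \<sigma> j"
    using Max_in[OF fin] S by blast+
  then have M: "?M \<in> euler_genus_spectrum G \<sigma>" "?M mod 2 = i mod 2"
    and N: "?N \<in> euler_genus_spectrum G \<sigma>" "?N mod 2 = j mod 2" by (simp_all add: parity_spectrum_def)
  have odd: "odd (?M - ?N)" using M(2) N(2) ij by presburger
  have "x \<le> ?M" if x: "x \<in> euler_genus_spectrum G \<sigma>" for x
  proof -
    have "x mod 2 = i mod 2 \<or> x mod 2 = j mod 2" using ij by presburger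
    then have "x \<in> parity_spectrum G \<sigma> i \<or> x \<in> parity_spectrum G \<sigma> j"
      using x by (simp add: parity_spectrum_def)
    then show ?thesis using Max_ge[OF fin] le by (meson order_trans)
  qed
  then have "?M - 1 \<in> euler_genus_spectrum G \<sigma>" by (rule spectrum_below_max[OF M(1) _ N(1) odd])
  moreover have "(?M - 1) mod 2 = j mod 2" using M(2) ij by presburger
  ultimately have "?M - 1 \<in> parity_spectrum G \<sigma> j" unfolding parity_spectrum_def by blast
  then have "?M - 1 \<le> ?N" by (rule Max_ge[OF fin])
  moreover have "?M \<noteq> ?N" using odd by auto
  ultimately show ?thesis using le by linarith
qed

theorem theorem1p3:
  fixes G :: "('v, 'e) pre_digraph" and \<sigma> :: "'e \<Rightarrow> int"
  assumes "signed_graph G \<sigma>"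
    and "connected G"
    and "parity_spectrum G \<sigma> 0 \<noteq> {}"
    and "parity_spectrum G \<sigma> 1 \<noteq> {}"
  shows "\<bar>Max (parity_spectrum G \<sigma> 0) - Max (parity_spectrum G \<sigma> 1)\<bar> = 1"
proof -
  interpret signed_graph G \<sigma> by fact
  show ?thesis
    using Max_parity_spectrum_adjacent[OF assms(3,4)] Max_parity_spectrum_adjacent[OF assms(4,3)]
    by (cases "Max (parity_spectrum G \<sigma> 1) \<le> Max (parity_spectrum G \<sigma> 0)") simp_all
qed

end
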